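(* For all constants $0<a_1\le a_2<\infty$ there is a constant $A>0$ depending only on $a_1,a_2$ such that the following holds. Let $n\ge1$, $\delta\in(0,1/3)$, $\gamma>0$. Suppose that $(X,Y),(X_1,Y_1),\dots,(X_n,Y_n)$ are i.i.d., that $\varepsilon=Y-g(X)$ is sub-Gaussian conditionally on $X$ with parameter $\sigma^2$, that $g$ is $L$-Lipschitz on $S_X$, and that the local map $\mathcal V$ (possibly random and depending on the sample) satisfies the minimal mass assumption with function $\ell$, is VC with dimension $v$, is $(\delta,n)$-large, and is $\gamma$-shape-regular. Suppose moreover that for all $x\in S_X$, $$a_1\left(\frac{\log((n+1)^v/\delta)}{n}\right)^{d/(d+2)}\le\lambda(\mathcal V(x))\le a_2\left(\frac{\log((n+1)^v/\delta)}{n}\right)^{d/(d+2)}.$$ Then, with probability at least $1-3\delta$, for all $x\in S_X$, $$|\hat g_{\mathcal V}(x)-g(x)|\le A\left(\sqrt{\frac{3\sigma^2}{\ell(x)}}+L(\mathcal V(x))\gamma^{1/d}\right)\left(\frac{\log\left(\frac{(n+1)^v}{\delta}\right)}{n}\right)^{1/(d+2)}.$$ In addition, whenever $S_X$ is bounded and $\ell(x)\ge b>0$ for all $x\in S_X$, we have, with probability at least $1-3\delta$, $$\sup_{x\in S_X}|\hat g_{\mathcal V}(x)-g(x)|\le A\left(\sqrt{\frac{3\sigma^2}{b}}+L\gamma^{1/d}\right)\left(\frac{\log\left(\frac{(n+1)^v}{\delta}\right)}{n}\right)^{1/(d+2)}.$$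
   Context: Setting: $d\ge1$; $(X,Y)$ is a random vector with law $P$ on $\mathbb R^d\times\mathbb R$, $X$ takes values in $S_X\subset\mathbb R^d$ and has law $P^X$, $g(x)=\mathbb E[Y\mid X=x]$, $\varepsilon=Y-g(X)$. Sub-Gaussian conditionally on $X$ with parameter $\sigma^2$: $\mathbb E[\varepsilon\mid X]=0$ and $\mathbb E[\exp(t\varepsilon)\mid X]\le\exp(t^2\sigma^2/2)$ a.s. for all $t\in\mathbb R$. Lipschitz is with respect to $\|\cdot\|_2$. For $V\subset S_X$, $L(V)$ is the smallest constant such that $|g(x)-g(y)|\le L(V)\|x-y\|_2$ for all $x,y\in V$. $\mathrm{diam}(V)=\sup_{x,y\in V}\|x-y\|_2$; $\lambda$ is Lebesgue measure on $\mathbb R^d$; $nP_n^X(A)=\sum_{i=1}^n\mathbf 1_A(X_i)$. A local map is a mapping $\mathcal V:S_X\to\mathcal B(S_X)$ (Borel subsets of $S_X$) with $x\in\mathcal V(x)$ for all $x$ and every $\mathcal V(x)$ of positive Lebesgue measure. It may be random and depend on $(X_i,Y_i)_{i\le n}$. The estimator is $\hat g_{\mathcal V}(x)=\sum_{i=1}^nY_i\mathbf 1_{\mathcal V(x)}(X_i)/\sum_{i=1}^n\mathbf 1_{\mathcal V(x)}(X_i)$, with $0/0=0$. VC with dimension $v$: there is a fixed collection $\mathcal A$ of subsets of $\mathbb R^d$ of VC dimension $v$ with $\{\mathcal V(x):x\in S_X\}\subset\mathcal A$. Minimal mass assumption with function $\ell:S_X\to(0,\infty)$: almost surely, for all $x\in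 S_X$, $P^X(\mathcal V(x))\ge\ell(x)\lambda(\mathcal V(x))$. $(\delta,n)$-large: almost surely, for all $x\in S_X$, $n\max(P_n^X(\mathcal V(x)),P^X(\mathcal V(x)))\ge8\log\left(4(2n+1)^v/\delta\right)$. $\gamma$-shape-regular local map: $\mathrm{diam}(\mathcal V(x))^d\le\gamma\,\lambda(\mathcal V(x))$ for all $x\in S_X$.
   Formalization: The VC collection is also assumed trace-measurable for samples from P^X (up to null sets); without this the claim is refutable under the continuum hypothesis. A is stated per underlying set of outcomes, uniform after pushing forward to the values of sample and map. *)

theory Defs
  imports "HOL-Probability.Probability"
begin

text \<open>
  The constant of the theorem must not depend on the dimension, so the dimension is a natural
  number \<open>d\<close> that can be quantified inside the statement. Points of d-space are
  functions in \<open>{..<d} \<rightarrow>\<^sub>E UNIV\<close>. The type class metric on \<^typ>\<open>nat \<Rightarrow> real\<close> is the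
  (bounded) metric of the infinite product; it is not the Euclidean one and is not used here.
\<close>

type_synonym point = "nat \<Rightarrow> real"

definition Rd :: "nat \<Rightarrow> point measure" where
  "Rd d = Pi\<^sub>M {..<d} (\<lambda>_. borel)"

definition leb :: "nat \<Rightarrow> point measure" where
  "leb d = Pi\<^sub>M {..<d} (\<lambda>_. lborel)"

definition edist :: "nat \<Rightarrow> point \<Rightarrow> point \<Rightarrow> real" where
  "edist d x y = L2_set (\<lambda>i. x i - y i) {..<d}"

definition ebounded :: "nat \<Rightarrow> point set \<Rightarrow> bool" where
  "ebounded d S \<longleftrightarrow> (\<exists>B. \<forall>x\<in>S. L2_set x {..<d} \<le> B)"

definition diam :: "nat \<Rightarrow> point set \<Rightarrow> ennreal" where
  "diam d V = (SUP x\<in>V. SUP y\<in>V. ennreal (edist d x y))"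

definition lipschitz :: "nat \<Rightarrow> real \<Rightarrow> point set \<Rightarrow> (point \<Rightarrow> real) \<Rightarrow> bool" where
  "lipschitz d K V g \<longleftrightarrow> 0 \<le> K \<and> (\<forall>x\<in>V. \<forall>y\<in>V. \<bar>g x - g y\<bar> \<le> K * edist d x y)"

definition lip_const :: "nat \<Rightarrow> (point \<Rightarrow> real) \<Rightarrow> point set \<Rightarrow> real" where
  "lip_const d g V = Inf {K. lipschitz d K V g}"

text \<open>
  The event need not be measurable (the local map is an arbitrary function of the outcome),
  so it is required to contain a measurable event of the stated probability.
\<close>

definition with_prob_at_least :: "'w measure \<Rightarrow> real \<Rightarrow> ('w \<Rightarrow> bool) \<Rightarrow> bool" where
  "with_prob_at_least M p Q \<longleftrightarrow> (\<exists>E\<in>sets M. p \<le> measure M E \<and> (\<forall>\<omega>\<in>E. Q \<omega>))"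

text \<open>Index 0 carries the generic pair (X,Y), indices 1 to n carry the sample.\<close>

definition iid_pairs ::
  "'w measure \<Rightarrow> nat \<Rightarrow> nat \<Rightarrow> (nat \<Rightarrow> 'w \<Rightarrow> point) \<Rightarrow> (nat \<Rightarrow> 'w \<Rightarrow> real) \<Rightarrow> bool" where
  "iid_pairs M d n X Y \<longleftrightarrow>
     prob_space.indep_vars M (\<lambda>_. Rd d \<Otimes>\<^sub>M borel) (\<lambda>i \<omega>. (X i \<omega>, Y i \<omega>)) {0..n} \<and>
     (\<forall>i\<in>{0..n}. distr M (Rd d \<Otimes>\<^sub>M borel) (\<lambda>\<omega>. (X i \<omega>, Y i \<omega>))
                = distr M (Rd d \<Otimes>\<^sub>M borel) (\<lambda>\<omega>. (X 0 \<omega>, Y 0 \<omega>)))"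

definition law :: "'w measure \<Rightarrow> nat \<Rightarrow> ('w \<Rightarrow> point) \<Rightarrow> point measure" where
  "law M d X = distr M (Rd d) X"

definition gen_algebra :: "'w measure \<Rightarrow> nat \<Rightarrow> ('w \<Rightarrow> point) \<Rightarrow> 'w measure" where
  "gen_algebra M d X = vimage_algebra (space M) X (Rd d)"

text \<open>
  \<open>g x = E[Y | X = x]\<close>. Measurability of \<open>g\<close> on the whole space only fixes
  its irrelevant values off the range of \<open>X\<close>.
\<close>

definition regression_fun ::
  "'w measure \<Rightarrow> nat \<Rightarrow> ('w \<Rightarrow> point) \<Rightarrow> ('w \<Rightarrow> real) \<Rightarrow> (point \<Rightarrow> real) \<Rightarrow> bool" where
  "regression_fun M d X Y g \<longleftrightarrow>
     integrable M Y \<and> g \<in> borel_measurable (Rd d) \<and>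
     (AE \<omega> in M. real_cond_exp M (gen_algebra M d X) Y \<omega> = g (X \<omega>))"

text \<open>
  The conditional exponential moment is taken in \<^typ>\<open>ennreal\<close> because
  \<^const>\<open>real_cond_exp\<close> has no meaning for non-integrable functions.
\<close>

definition cond_subgaussian ::
  "'w measure \<Rightarrow> nat \<Rightarrow> ('w \<Rightarrow> point) \<Rightarrow> ('w \<Rightarrow> real) \<Rightarrow> real \<Rightarrow> bool" where
  "cond_subgaussian M d X \<epsilon> s \<longleftrightarrow>
     (AE \<omega> in M. real_cond_exp M (gen_algebra M d X) \<epsilon> \<omega> = 0) \<and>
     (\<forall>t::real. AE \<omega> in M.
        nn_cond_exp M (gen_algebra M d X) (\<lambda>\<omega>'. ennreal (exp (t * \<epsilon> \<omega>'))) \<omega>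
          \<le> ennreal (exp (t\<^sup>2 * s / 2)))"

definition local_map :: "nat \<Rightarrow> point set \<Rightarrow> (point \<Rightarrow> point set) \<Rightarrow> bool" where
  "local_map d S V \<longleftrightarrow>
     (\<forall>x\<in>S. V x \<in> sets (Rd d) \<and> V x \<subseteq> S \<and> x \<in> V x \<and> 0 < emeasure (leb d) (V x))"

definition emp :: "nat \<Rightarrow> (nat \<Rightarrow> 'w \<Rightarrow> point) \<Rightarrow> 'w \<Rightarrow> point set \<Rightarrow> real" where
  "emp n X \<omega> A = (\<Sum>i=1..n. indicator A (X i \<omega>)) / real n"

definition ghat ::
  "nat \<Rightarrow> (nat \<Rightarrow> 'w \<Rightarrow> point) \<Rightarrow> (nat \<Rightarrow> 'w \<Rightarrow> real) \<Rightarrow> ('w \<Rightarrow> point \<Rightarrow> point set) \<Rightarrow>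
    'w \<Rightarrow> point \<Rightarrow> real" where
  "ghat n X Y V \<omega> x =
     (\<Sum>i=1..n. Y i \<omega> * indicator (V \<omega> x) (X i \<omega>)) / (\<Sum>i=1..n. indicator (V \<omega> x) (X i \<omega>))"

definition shatters :: "'a set set \<Rightarrow> 'a set \<Rightarrow> bool" where
  "shatters \<A> F \<longleftrightarrow> (\<forall>T\<subseteq>F. \<exists>A\<in>\<A>. A \<inter> F = T)"

definition has_vc_dim :: "'a set set \<Rightarrow> nat \<Rightarrow> bool" where
  "has_vc_dim \<A> v \<longleftrightarrow>
     (\<exists>F. finite F \<and> card F = v \<and> shatters \<A> F) \<and>
     (\<forall>F. finite F \<and> shatters \<A> F \<longrightarrow> card F \<le> v)"

text \<open>
  The usual measurability proviso of Vapnik--Chervonenkis theory: for every m and every set I of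
  indices, it is a measurable event (up to null sets) for an m-tuple drawn from N
  that some member of the class picks out exactly the points with index in I. It holds
  for instance for countable classes of measurable sets, for pointwise measurable classes
  and for image admissible Suslin classes. Without some such proviso uniform deviation bounds
  over a class of finite VC dimension can fail (under the continuum hypothesis, take initial
  segments of a well-ordering of the line of type \<open>\<omega>\<^sub>1\<close>).
\<close>

definition trace_measurable :: "'a measure \<Rightarrow> 'a set set \<Rightarrow> bool" where
  "trace_measurable N \<A> \<longleftrightarrow>
     (\<forall>m. \<forall>I\<subseteq>{..<m::nat}.
        {x \<in> space (Pi\<^sub>M {..<m} (\<lambda>_. N)). \<exists>A\<in>\<A>. {i\<in>{..<m}. x i \<in> A} = I}
          \<in> sets (completion (Pi\<^sub>M {..<m} (\<lambda>_. N))))"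

definition vc_map ::
  "'w measure \<Rightarrow> nat \<Rightarrow> point measure \<Rightarrow> point set \<Rightarrow> ('w \<Rightarrow> point \<Rightarrow> point set) \<Rightarrow> nat \<Rightarrow> bool" where
  "vc_map M d PX S V v \<longleftrightarrow>
     (\<exists>\<A>. \<A> \<subseteq> Pow (space (Rd d)) \<and> has_vc_dim \<A> v \<and> trace_measurable PX \<A> \<and>
          (\<forall>\<omega>\<in>space M. \<forall>x\<in>S. V \<omega> x \<in> \<A>))"

definition minimal_mass ::
  "'w measure \<Rightarrow> nat \<Rightarrow> point measure \<Rightarrow> point set \<Rightarrow> ('w \<Rightarrow> point \<Rightarrow> point set) \<Rightarrow>
    (point \<Rightarrow> real) \<Rightarrow> bool" where
  "minimal_mass M d PX S V ell \<longleftrightarrow>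
     (\<forall>x\<in>S. 0 < ell x) \<and>
     (AE \<omega> in M. \<forall>x\<in>S. ennreal (ell x) * emeasure (leb d) (V \<omega> x) \<le> emeasure PX (V \<omega> x))"

definition large_map ::
  "'w measure \<Rightarrow> nat \<Rightarrow> (nat \<Rightarrow> 'w \<Rightarrow> point) \<Rightarrow> point measure \<Rightarrow> point set \<Rightarrow>
    ('w \<Rightarrow> point \<Rightarrow> point set) \<Rightarrow> nat \<Rightarrow> real \<Rightarrow> bool" where
  "large_map M n X PX S V v \<delta> \<longleftrightarrow>
     (AE \<omega> in M. \<forall>x\<in>S.
        8 * ln (4 * (2 * real n + 1) ^ v / \<delta>)
          \<le> real n * max (emp n X \<omega> (V \<omega> x)) (measure PX (V \<omega> x)))"

definition shape_regular :: "nat \<Rightarrow> point set \<Rightarrow> real \<Rightarrow> (point \<Rightarrow> point set) \<Rightarrow> bool" where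
  "shape_regular d S \<gamma> V \<longleftrightarrow>
     (\<forall>x\<in>S. diam d (V x) ^ d \<le> ennreal \<gamma> * emeasure (leb d) (V x))"

definition rate :: "nat \<Rightarrow> nat \<Rightarrow> real \<Rightarrow> real" where
  "rate n v \<delta> = ln ((real n + 1) ^ v / \<delta>) / real n"

end

theory Submission imports Defs begin

text \<open>
  Write \<open>N\<close> for the number of sample points in \<open>\<V>(x)\<close>. The error splits into a noise average and a
  bias. By shape regularity the bias is at most \<open>L(\<V>(x))\<close> times a diameter of order
  \<open>(\<gamma> \<lambda>(\<V>(x)))\<close> to the power \<open>1/d\<close>. Conditionally on the design, a union bound over the at most
  \<open>(n+1)\<^sup>v\<close> traces of the class (Sauer--Shelah) makes the noise average at most
  \<open>sqrt (2 \<sigma>\<^sup>2 log (2 (n+1)\<^sup>v / \<delta>) / N)\<close> with probability \<open>1 - \<delta>\<close>.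

  It remains to bound \<open>N\<close> from below. Symmetrization with a ghost sample shows that, outside an event
  of probability \<open>\<delta>\<close>, every set \<open>A\<close> of the class with \<open>n P(A) \<ge> 8 log (4 (2n+1)\<^sup>v / \<delta>)\<close> contains at
  least \<open>n P(A) / 16\<close> sample points. For \<open>A = \<V>(x)\<close> largeness of the map removes the restriction on
  \<open>A\<close>, and the minimal mass assumption turns this into a multiple of \<open>n \<ell>(x) \<lambda>(\<V>(x))\<close>.
\<close>

section \<open>Traces of Vapnik--Chervonenkis classes\<close>

text \<open>The map is an arbitrary function of the outcome, so no probability estimate can be made
  for a single \<open>V \<omega> x\<close>; each one is made for all members of the class at once,
  and \<open>V \<omega> x\<close> is inserted after the outcome is fixed. The class itself enters
  probability only through the events that a given index set is cut out of the sample, which are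
  measurable up to null sets. Which index sets are traces is random. The union bounds therefore run
  over all index sets I, and each tail bound carries the probability of the trace event of I as a
  factor. These probabilities add up to the expected number of traces, so only that number is paid
  for. The factor survives in the noise bound because the trace is a function of the design and the
  tail is conditional on it, and in the counting bound because exchanging sample and ghost points
  permutes the trace events without changing their probabilities.\<close>

text \<open>Pajor's form of the Sauer--Shelah lemma. Deleting x from the ground set merges two
  members into one exactly at the elements of \<C>, so \<A> has as many members as \<B> and \<C>
  together. A set shattered by \<B> is shattered by \<A>, and a set shattered by \<C> stays
  shattered after x is added.\<close>

lemma card_le_card_shattered:
  assumes "finite F" "\<A> \<subseteq> Pow F"
  shows "card \<A> \<le> card {T. T \<subseteq> F \<and> shatters \<A> T}"
  using assms
proof (induction F arbitrary: \<A> rule: finite_induct)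
  case empty
  show ?case
  proof (cases "\<A> = {}")
    case False
    with empty have "\<A> = {{}}" by (auto simp: subset_singleton_iff)
    then have "{T. T \<subseteq> {} \<and> shatters \<A> T} = {{}}" by (auto simp: shatters_def)
    with \<open>\<A> = {{}}\<close> show ?thesis by simp
  qed simp
next
  case (insert x F)
  define \<B> where "\<B> = (\<lambda>A. A - {x}) ` \<A>"
  define \<C> where "\<C> = {A. A \<subseteq> F \<and> A \<in> \<A> \<and> insert x A \<in> \<A>}"
  have fin: "finite \<A>" using insert.prems insert.hyps by (meson finite.insertI finite_Pow_iff finite_subset)
  have B: "card \<B> \<le> card {T. T \<subseteq> F \<and> shatters \<B> T}"
    using insert.prems by (intro insert.IH) (auto simp: \<B>_def)
  have C: "card \<C> \<le> card {T. T \<subseteq> F \<and> shatters \<C> T}"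
    by (intro insert.IH) (auto simp: \<C>_def)
  have "card \<A> = card {A \<in> \<A>. x \<notin> A} + card {A \<in> \<A>. x \<in> A}"
    using fin by (subst card_Un_disjoint [symmetric]) (auto intro!: arg_cong[where f = card])
  also have "card {A \<in> \<A>. x \<in> A} = card ((\<lambda>A. A - {x}) ` {A \<in> \<A>. x \<in> A})"
    by (intro card_image [symmetric] inj_onI) blast
  also have "card {A \<in> \<A>. x \<notin> A} + \<dots> =
      card ({A \<in> \<A>. x \<notin> A} \<union> (\<lambda>A. A - {x}) ` {A \<in> \<A>. x \<in> A})
    + card ({A \<in> \<A>. x \<notin> A} \<inter> (\<lambda>A. A - {x}) ` {A \<in> \<A>. x \<in> A})"
    using fin by (intro card_Un_Int) auto
  also have "{A \<in> \<A>. x \<notin> A} \<union> (\<lambda>A. A - {x}) ` {A \<in> \<A>. x \<in> A} = \<B>"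
  proof (intro equalityI subsetI)
    fix A assume "A \<in> {A \<in> \<A>. x \<notin> A} \<union> (\<lambda>A. A - {x}) ` {A \<in> \<A>. x \<in> A}"
    then show "A \<in> \<B>"
    proof
      assume "A \<in> {A \<in> \<A>. x \<notin> A}"
      then show ?thesis unfolding \<B>_def by (intro image_eqI[of _ _ A]) auto
    qed (auto simp: \<B>_def)
  next
    fix A assume "A \<in> \<B>"
    then obtain A' where "A' \<in> \<A>" "A = A' - {x}" by (auto simp: \<B>_def)
    then show "A \<in> {A \<in> \<A>. x \<notin> A} \<union> (\<lambda>A. A - {x}) ` {A \<in> \<A>. x \<in> A}"
      by (cases "x \<in> A'") auto
  qed
  also have "{A \<in> \<A>. x \<notin> A} \<inter> (\<lambda>A. A - {x}) ` {A \<in> \<A>. x \<in> A} = \<C>"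
  proof (intro equalityI subsetI)
    fix A assume "A \<in> {A \<in> \<A>. x \<notin> A} \<inter> (\<lambda>A. A - {x}) ` {A \<in> \<A>. x \<in> A}"
    then obtain A' where "A \<in> \<A>" "x \<notin> A" "A' \<in> \<A>" "x \<in> A'" "A = A' - {x}" by blast
    then show "A \<in> \<C>" using insert.prems by (auto simp: \<C>_def insert_absorb)
  next
    fix A assume A: "A \<in> \<C>"
    then have "x \<notin> A" using insert.hyps by (auto simp: \<C>_def)
    then have "A = insert x A - {x}" by simp
    with A \<open>x \<notin> A\<close> show "A \<in> {A \<in> \<A>. x \<notin> A} \<inter> (\<lambda>A. A - {x}) ` {A \<in> \<A>. x \<in> A}"
      by (auto simp: \<C>_def)
  qed
  finally have "card \<A> = card \<B> + card \<C>" .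
  also have "\<dots> \<le> card {T. T \<subseteq> F \<and> shatters \<B> T} + card (insert x ` {T. T \<subseteq> F \<and> shatters \<C> T})"
  proof -
    have "card (insert x ` {T. T \<subseteq> F \<and> shatters \<C> T}) = card {T. T \<subseteq> F \<and> shatters \<C> T}"
      using insert.hyps by (intro card_image inj_onI) (auto simp: insert_eq_iff subset_iff)
    with B C show ?thesis by linarith
  qed
  \<comment> \<open>Sets of the first kind avoid x and those of the second kind contain it.\<close>
  also have "\<dots> = card ({T. T \<subseteq> F \<and> shatters \<B> T} \<union> insert x ` {T. T \<subseteq> F \<and> shatters \<C> T})"
    using insert.hyps by (intro card_Un_disjoint [symmetric]) auto
  also have "\<dots> \<le> card {T. T \<subseteq> insert x F \<and> shatters \<A> T}"
  proof (intro card_mono)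
    show "finite {T. T \<subseteq> insert x F \<and> shatters \<A> T}" using insert.hyps by simp
    have "shatters \<A> T" if T: "T \<subseteq> F" "shatters \<B> T" for T
      unfolding shatters_def
    proof (intro allI impI)
      fix U assume "U \<subseteq> T"
      with T(2) have "\<exists>A\<in>\<B>. A \<inter> T = U" by (simp add: shatters_def)
      then obtain A where "A \<in> \<A>" "(A - {x}) \<inter> T = U" by (auto simp: \<B>_def)
      moreover have "(A - {x}) \<inter> T = A \<inter> T" using T(1) insert.hyps(2) by blast
      ultimately show "\<exists>A\<in>\<A>. A \<inter> T = U" by blast
    qed
    moreover have "shatters \<A> (insert x T)" if T: "T \<subseteq> F" "shatters \<C> T" for T
      unfolding shatters_def
    proof (intro allI impI)
      fix U assume U: "U \<subseteq> insert x T"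
      then have "U - {x} \<subseteq> T" by blast
      with T(2) have "\<exists>A\<in>\<C>. A \<inter> T = U - {x}" by (simp add: shatters_def)
      then obtain A where A: "A \<in> \<C>" "A \<inter> T = U - {x}" by blast
      have "x \<notin> A" "x \<notin> T" using A(1) T(1) insert.hyps(2) by (auto simp: \<C>_def)
      show "\<exists>A\<in>\<A>. A \<inter> insert x T = U"
      proof (cases "x \<in> U")
        case True
        then have "insert x A \<inter> insert x T = U" using A(2) by blast
        moreover have "insert x A \<in> \<A>" using A(1) by (simp add: \<C>_def)
        ultimately show ?thesis by (rule bexI)
      next
        case False
        then have "A \<inter> insert x T = U" using A(2) \<open>x \<notin> A\<close> by blast
        moreover have "A \<in> \<A>" using A(1) by (simp add: \<C>_def)
        ultimately show ?thesis by (rule bexI)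
      qed
    qed
    ultimately show "{T. T \<subseteq> F \<and> shatters \<B> T} \<union> insert x ` {T. T \<subseteq> F \<and> shatters \<C> T}
        \<subseteq> {T. T \<subseteq> insert x F \<and> shatters \<A> T}"
      by blast
  qed
  finally show ?case .
qed

text \<open>A set with at most v elements is spelled by a word of length v over F and one blank
  letter \<open>None\<close>, which pads the words of smaller sets. Counting words gives the power
  directly, without a sum of binomial coefficients.\<close>

lemma card_subsets_card_le:
  assumes "finite F"
  shows "card {T. T \<subseteq> F \<and> card T \<le> v} \<le> (card F + 1) ^ v"
proof -
  let ?E = "{..<v} \<rightarrow>\<^sub>E insert None (Some ` F)"
  have fin: "finite ?E" using assms by (intro finite_PiE) auto
  have "{T. T \<subseteq> F \<and> card T \<le> v} \<subseteq> (\<lambda>f. Some -` (f ` {..<v})) ` ?E"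
  proof
    fix T assume "T \<in> {T. T \<subseteq> F \<and> card T \<le> v}"
    then have T: "T \<subseteq> F" "card T \<le> v" by auto
    then have "finite T" using assms finite_subset by blast
    then obtain h where h: "bij_betw h {..<card T} T"
      by (metis ex_bij_betw_nat_finite atLeast0LessThan)
    have hF: "h i \<in> F" if "i < card T" for i
      using h T that by (auto simp: bij_betw_def)
    define f where "f = (\<lambda>i\<in>{..<v}. if i < card T then Some (h i) else None)"
    have "f \<in> ?E" using hF by (auto simp: f_def)
    moreover have "Some -` (f ` {..<v}) = T"
    proof -
      have "Some y \<in> f ` {..<v} \<longleftrightarrow> y \<in> h ` {..<card T}" for y
      proof
        assume "Some y \<in> f ` {..<v}"
        then show "y \<in> h ` {..<card T}" by (auto simp: f_def split: if_splits)
      next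
        assume "y \<in> h ` {..<card T}"
        then obtain i where "i < card T" "y = h i" by auto
        with T show "Some y \<in> f ` {..<v}" by (auto simp: f_def intro!: rev_image_eqI[of i])
      qed
      then show ?thesis using h by (auto simp: bij_betw_def)
    qed
    ultimately show "T \<in> (\<lambda>f. Some -` (f ` {..<v})) ` ?E" by (intro image_eqI) auto
  qed
  then have "card {T. T \<subseteq> F \<and> card T \<le> v} \<le> card ?E"
    using fin by (rule surj_card_le [rotated])
  also have "\<dots> = (card F + 1) ^ v"
    using assms by (simp add: card_PiE card_image)
  finally show ?thesis .
qed

lemma sauer_shelah:
  assumes "has_vc_dim \<A> v" "finite F"
  shows "card ((\<lambda>A. A \<inter> F) ` \<A>) \<le> (card F + 1) ^ v"
proof -
  let ?\<A> = "(\<lambda>A. A \<inter> F) ` \<A>"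
  have "card ?\<A> \<le> card {T. T \<subseteq> F \<and> shatters ?\<A> T}"
    using assms(2) by (intro card_le_card_shattered) auto
  also have "\<dots> \<le> card {T. T \<subseteq> F \<and> card T \<le> v}"
  proof (intro card_mono)
    show "finite {T. T \<subseteq> F \<and> card T \<le> v}" using assms(2) by simp
    have "card T \<le> v" if "T \<subseteq> F" "shatters ?\<A> T" for T
    proof -
      have "A \<inter> F \<inter> T = A \<inter> T" for A using that by blast
      then have "shatters \<A> T" using that(2) by (simp add: shatters_def)
      moreover have "finite T" using that assms(2) finite_subset by blast
      ultimately show ?thesis using assms(1) by (auto simp: has_vc_dim_def)
    qed
    then show "{T. T \<subseteq> F \<and> shatters ?\<A> T} \<subseteq> {T. T \<subseteq> F \<and> card T \<le> v}" by auto
  qed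
  also have "\<dots> \<le> (card F + 1) ^ v" by (rule card_subsets_card_le [OF assms(2)])
  finally show ?thesis .
qed

text \<open>Indices rather than points are recorded because sample points may coincide and because
  the symmetrization below permutes indices.\<close>

definition hits :: "nat \<Rightarrow> (nat \<Rightarrow> 'a) \<Rightarrow> 'a set \<Rightarrow> nat set" where
  "hits m x A = {i \<in> {..<m}. x i \<in> A}"

text \<open>The index trace is determined by the trace on the set of sample points, and repeated
  points only make that set smaller.\<close>

lemma card_hits_le:
  assumes "has_vc_dim \<A> v"
  shows "card (hits m x ` \<A>) \<le> (m + 1) ^ v"
proof -
  let ?F = "x ` {..<m}"
  have "hits m x A = hits m x (A \<inter> ?F)" for A by (auto simp: hits_def)
  then have "hits m x ` \<A> = hits m x ` (\<lambda>A. A \<inter> ?F) ` \<A>"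
    by (simp add: image_image)
  moreover have "finite ((\<lambda>A. A \<inter> ?F) ` \<A>)" by (rule finite_subset[of _ "Pow ?F"]) auto
  ultimately have "card (hits m x ` \<A>) \<le> card ((\<lambda>A. A \<inter> ?F) ` \<A>)"
    by (metis card_image_le)
  also have "\<dots> \<le> (card ?F + 1) ^ v" using assms by (intro sauer_shelah) auto
  also have "\<dots> \<le> (m + 1) ^ v"
    using card_image_le[of "{..<m}" x] by (intro power_mono) auto
  finally show ?thesis .
qed

text \<open>
  Trace events are measurable only up to null sets; the sets \<open>T I\<close> are measurable versions that
  contain them everywhere, so that inclusions between events need no exceptional null set.
\<close>

lemma trace_hull:
  assumes "prob_space N" "trace_measurable N \<A>" "has_vc_dim \<A> v"
  obtains T where "\<And>I. T I \<in> sets (Pi\<^sub>M {..<m} (\<lambda>_. N))"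
    "\<And>x A. x \<in> space (Pi\<^sub>M {..<m} (\<lambda>_. N)) \<Longrightarrow> A \<in> \<A> \<Longrightarrow> x \<in> T (hits m x A)"
    "AE x in Pi\<^sub>M {..<m} (\<lambda>_. N). \<forall>I\<in>Pow {..<m}. x \<in> T I \<longleftrightarrow> I \<in> hits m x ` \<A>"
    "(\<Sum>I\<in>Pow {..<m}. emeasure (Pi\<^sub>M {..<m} (\<lambda>_. N)) (T I)) \<le> ennreal ((real m + 1) ^ v)"
proof -
  let ?P = "Pi\<^sub>M {..<m} (\<lambda>_. N)"
  interpret N: prob_space N by fact
  interpret P: prob_space ?P by (intro prob_space_PiM assms)
  have "\<exists>T. T \<in> sets ?P \<and>
      {x \<in> space ?P. I \<in> hits m x ` \<A>} \<subseteq> T \<and> (AE x in ?P. x \<in> T \<longleftrightarrow> I \<in> hits m x ` \<A>)"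
    if "I \<subseteq> {..<m}" for I
  proof -
    let ?H = "{x \<in> space ?P. I \<in> hits m x ` \<A>}"
    have "?H = {x \<in> space ?P. \<exists>A\<in>\<A>. {i\<in>{..<m}. x i \<in> A} = I}"
      by (auto simp: hits_def)
    then have "?H \<in> sets (completion ?P)"
      using assms(2) that by (simp add: trace_measurable_def)
    \<comment> \<open>A set in the completion is a measurable S plus part of a null set Z'. Adding
      all of Z' gives a measurable superset that differs from it by a null set.\<close>
    then obtain S Z Z' where *: "?H = S \<union> Z" "Z \<subseteq> Z'" "Z' \<in> null_sets ?P" "S \<in> sets ?P"
      by (rule sets_completionE)
    have "AE x in ?P. x \<in> S \<union> Z' \<longleftrightarrow> I \<in> hits m x ` \<A>"
      using AE_not_in[OF *(3)] AE_space
    proof eventually_elim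
      case (elim x)
      then have "x \<in> S \<union> Z' \<longleftrightarrow> x \<in> S \<union> Z" using *(2) by auto
      also have "\<dots> \<longleftrightarrow> I \<in> hits m x ` \<A>" using *(1) elim(2) by blast
      finally show ?case .
    qed
    with * show ?thesis by (intro exI[of _ "S \<union> Z'"]) auto
  qed
  then have "\<forall>I\<in>Pow {..<m}. \<exists>T. T \<in> sets ?P \<and>
      {x \<in> space ?P. I \<in> hits m x ` \<A>} \<subseteq> T \<and> (AE x in ?P. x \<in> T \<longleftrightarrow> I \<in> hits m x ` \<A>)"
    by blast
  from bchoice[OF this] obtain T0 where T0: "\<And>I. I \<subseteq> {..<m} \<Longrightarrow> T0 I \<in> sets ?P \<and>
      {x \<in> space ?P. I \<in> hits m x ` \<A>} \<subseteq> T0 I \<and> (AE x in ?P. x \<in> T0 I \<longleftrightarrow> I \<in> hits m x ` \<A>)"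
    by blast
  define T where "T I = (if I \<subseteq> {..<m} then T0 I else {})" for I
  have T: "\<And>I. T I \<in> sets ?P"
      "\<And>I. I \<subseteq> {..<m} \<Longrightarrow> {x \<in> space ?P. I \<in> hits m x ` \<A>} \<subseteq> T I"
      "\<And>I. I \<subseteq> {..<m} \<Longrightarrow> (AE x in ?P. x \<in> T I \<longleftrightarrow> I \<in> hits m x ` \<A>)"
    using T0 by (auto simp: T_def)
  have ae: "AE x in ?P. \<forall>I\<in>Pow {..<m}. x \<in> T I \<longleftrightarrow> I \<in> hits m x ` \<A>"
    using T(3) by (intro AE_finite_allI) auto
  \<comment> \<open>The sum is the expected number of hulls containing x, which is almost surely the
    number of traces of x.\<close>
  have "(\<Sum>I\<in>Pow {..<m}. emeasure ?P (T I)) = (\<integral>\<^sup>+x. (\<Sum>I\<in>Pow {..<m}. indicator (T I) x) \<partial>?P)"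
    using T(1) by (subst nn_integral_sum) auto
  also have "\<dots> \<le> (\<integral>\<^sup>+x. ennreal ((real m + 1) ^ v) \<partial>?P)"
  proof (rule nn_integral_mono_AE)
    show "AE x in ?P. (\<Sum>I\<in>Pow {..<m}. indicator (T I) x) \<le> ennreal ((real m + 1) ^ v)"
      using ae
    proof eventually_elim
      case (elim x)
      have "(\<Sum>I\<in>Pow {..<m}. indicator (T I) x) = (\<Sum>I\<in>Pow {..<m}. indicator (hits m x ` \<A>) I :: ennreal)"
        using elim by (intro sum.cong) (auto simp: indicator_def)
      also have "\<dots> = of_nat (card (Pow {..<m} \<inter> hits m x ` \<A>))"
        by (simp add: indicator_def sum.If_cases)
      also have "Pow {..<m} \<inter> hits m x ` \<A> = hits m x ` \<A>" by (auto simp: hits_def)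
      also have "of_nat (card (hits m x ` \<A>)) \<le> (of_nat ((m + 1) ^ v) :: ennreal)"
        using card_hits_le[OF assms(3), of m x] by (simp only: of_nat_le_iff)
      also have "\<dots> = ennreal ((real m + 1) ^ v)"
        unfolding ennreal_of_nat_eq_real_of_nat by (simp add: add.commute)
      finally show ?case .
    qed
  qed
  also have "\<dots> = ennreal ((real m + 1) ^ v)" by (simp add: P.emeasure_space_1)
  finally have "(\<Sum>I\<in>Pow {..<m}. emeasure ?P (T I)) \<le> ennreal ((real m + 1) ^ v)" .
  moreover have "x \<in> T (hits m x A)" if "x \<in> space ?P" "A \<in> \<A>" for x A
    using T(2)[of "hits m x A"] that by (auto simp: hits_def)
  ultimately show ?thesis
    using T(1) ae that[of T] by blast
qed

section \<open>Relative deviations by symmetrization\<close>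

text \<open>The involution exchanging sample index i with its ghost index i + n for each i in B. It
  is total and fixes everything from 2 * n on, so that it is an involution for every B.\<close>

definition swap_pairs :: "nat \<Rightarrow> nat set \<Rightarrow> nat \<Rightarrow> nat" where
  "swap_pairs n B i =
     (if i < n then if i \<in> B then i + n else i else if i < 2 * n \<and> i - n \<in> B then i - n else i)"

text \<open>The action on traces: permuting the double sample by \<open>swap_pairs n B\<close> turns
  its trace I into this set.\<close>

definition swap_set :: "nat \<Rightarrow> nat set \<Rightarrow> nat set \<Rightarrow> nat set" where
  "swap_set n B I = {i \<in> {..<2 * n}. swap_pairs n B i \<in> I}"

text \<open>
  The weights satisfy \<open>exp (1/2) + exp (- 2) \<le> 2\<close>, so that exchanging the two members of each
  pair by independent fair coins makes the expectation of \<open>exp excess\<close> at most 1.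
\<close>

definition excess :: "nat \<Rightarrow> nat set \<Rightarrow> real" where
  "excess n I = real (card (I \<inter> {n..<2 * n})) / 2 - 2 * real (card (I \<inter> {..<n}))"

lemma swap_pairs_invol: "swap_pairs n B (swap_pairs n B i) = i"
  by (auto simp: swap_pairs_def)

lemma swap_pairs_less_iff: "swap_pairs n B i < 2 * n \<longleftrightarrow> i < 2 * n"
  by (auto simp: swap_pairs_def)

lemma swap_set_invol: "I \<subseteq> {..<2 * n} \<Longrightarrow> swap_set n B (swap_set n B I) = I"
  by (auto simp: swap_set_def swap_pairs_invol swap_pairs_less_iff)

text \<open>Grouping by the pairs of i and i + n makes the exponential of the excess a product with
  one factor per pair.\<close>

lemma excess_eq_sum: "excess n I = (\<Sum>i<n. of_bool (i + n \<in> I) / 2 - 2 * of_bool (i \<in> I))"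
proof -
  have "card (I \<inter> {n..<2 * n}) = (\<Sum>i\<in>{n..<2 * n}. of_bool (i \<in> I))"
    by (simp add: Int_commute sum.inter_restrict [symmetric] of_bool_def sum.If_cases)
  also have "\<dots> = (\<Sum>i<n. of_bool (i + n \<in> I))"
    by (intro sum.reindex_bij_witness[of _ "\<lambda>i. i + n" "\<lambda>i. i - n"]) auto
  finally have "real (card (I \<inter> {n..<2 * n})) = (\<Sum>i<n. of_bool (i + n \<in> I))"
    by simp
  moreover have "real (card (I \<inter> {..<n})) = (\<Sum>i<n. of_bool (i \<in> I))"
    by (simp add: Int_commute of_bool_def sum.If_cases)
  ultimately show ?thesis
    by (simp only: excess_def sum_subtractf sum_distrib_left sum_divide_distrib)
qed

text \<open>The two terms are at most 7/4, since exp 1 \<le> 3 < 49/16, and 1/4, since exp 1 \<ge>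
  2.\<close>

lemma exp_half_plus_exp_minus_two_le: "exp (1/2) + exp (-2) \<le> (2::real)"
proof -
  have "(exp (1/2))\<^sup>2 = (exp 1 :: real)" by (simp add: power2_eq_square flip: exp_add)
  also have "\<dots> \<le> (7/4)\<^sup>2" using exp_le by (simp add: power2_eq_square)
  finally have "exp (1/2) \<le> (7/4 :: real)" by (rule power2_le_imp_le) simp
  moreover have "exp 1 \<ge> (2::real)" using exp_ge_add_one_self[of 1] by simp
  then have "exp 1 * exp 1 \<ge> 2 * (2::real)" by (intro mult_mono) auto
  then have "exp 2 \<ge> (4::real)" by (simp flip: exp_add)
  then have "exp (-2) \<le> (1/4::real)" by (simp add: exp_minus field_simps)
  ultimately show ?thesis by linarith
qed

text \<open>Summing over B expands the product over all pairs of \<open>u i + w i\<close>, the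
  swapped and the unswapped factor. Such a sum is 1 + 1 if the pair misses I, exp (1/2) + exp (-2)
  if I contains one member, and 2 exp (-3/2) if it contains both.\<close>

lemma sum_exp_excess_swap_le:
  "(\<Sum>B\<in>Pow {..<n}. exp (excess n (swap_set n B I))) \<le> 2 ^ n"
proof -
  define u where "u i = exp (of_bool (i \<in> I) / 2 - 2 * of_bool (i + n \<in> I) :: real)" for i
  define w where "w i = exp (of_bool (i + n \<in> I) / 2 - 2 * of_bool (i \<in> I) :: real)" for i
  have "exp (excess n (swap_set n B I)) = (\<Prod>i\<in>B. u i) * (\<Prod>i\<in>{..<n} - B. w i)"
    if "B \<in> Pow {..<n}" for B
  proof -
    have "exp (excess n (swap_set n B I)) = (\<Prod>i<n. if i \<in> B then u i else w i)"
      unfolding excess_eq_sum by (subst exp_sum) 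
        (auto intro!: prod.cong simp: u_def w_def swap_set_def swap_pairs_def)
    also have "\<dots> = (\<Prod>i\<in>B. u i) * (\<Prod>i\<in>{..<n} - B. w i)"
      using that by (simp add: prod.If_cases Int_absorb1 Diff_eq)
    finally show ?thesis .
  qed
  then have "(\<Sum>B\<in>Pow {..<n}. exp (excess n (swap_set n B I))) =
      (\<Sum>B\<in>Pow {..<n}. (\<Prod>i\<in>B. u i) * (\<Prod>i\<in>{..<n} - B. w i))"
    by (rule sum.cong[OF refl])
  also have "\<dots> = (\<Prod>i<n. u i + w i)" by (rule prod_add [symmetric]) simp
  also have "\<dots> \<le> (\<Prod>i<n. 2)"
  proof (intro prod_mono conjI)
    fix i
    show "0 \<le> u i + w i" by (simp add: u_def w_def add_nonneg_nonneg)
    have "exp (1/2 - 2) \<le> (1::real)" by simp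
    then show "u i + w i \<le> 2"
      using exp_half_plus_exp_minus_two_le
      by (cases "i \<in> I"; cases "i + n \<in> I") (simp_all add: u_def w_def)
  qed
  finally show ?thesis by simp
qed

text \<open>Permuting the coordinates of a product of identical factors preserves the measure, and
  pulls the trace event of I back to that of the swapped index set. The hulls inherit this because
  they agree with the trace events almost everywhere.\<close>

lemma measure_swap_set:
  assumes "prob_space N"
    and T: "\<And>I. T I \<in> sets (Pi\<^sub>M {..<2 * n} (\<lambda>_. N))"
    and ae: "AE x in Pi\<^sub>M {..<2 * n} (\<lambda>_. N). \<forall>I\<in>Pow {..<2 * n}. x \<in> T I \<longleftrightarrow> I \<in> hits (2 * n) x ` \<A>"
    and I: "I \<subseteq> {..<2 * n}"
  shows "measure (Pi\<^sub>M {..<2 * n} (\<lambda>_. N)) (T (swap_set n B I)) = measure (Pi\<^sub>M {..<2 * n} (\<lambda>_. N)) (T I)"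
proof -
  let ?P = "Pi\<^sub>M {..<2 * n} (\<lambda>_. N)"
  define \<pi> where "\<pi> x = (\<lambda>i\<in>{..<2 * n}. x (swap_pairs n B i))" for x :: "nat \<Rightarrow> 'a"
  have inj: "inj_on (swap_pairs n B) {..<2 * n}"
    by (metis inj_onI swap_pairs_invol)
  have range: "swap_pairs n B \<in> {..<2 * n} \<rightarrow> {..<2 * n}"
    by (auto simp: swap_pairs_less_iff)
  have distr: "distr ?P ?P \<pi> = ?P"
    using distr_PiM_reindex[of "{..<2 * n}" "\<lambda>_. N", OF assms(1) inj range]
    by (simp add: \<pi>_def[abs_def])
  have [measurable]: "\<pi> \<in> measurable ?P ?P"
    unfolding \<pi>_def[abs_def] using range
    by (intro measurable_restrict measurable_component_singleton) auto
  \<comment> \<open>The exceptional null set has to be avoided at \<open>\<pi> x\<close> as well as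
    at x; invariance of the product measure under \<pi> allows this.\<close>
  have "AE x in distr ?P ?P \<pi>. \<forall>I\<in>Pow {..<2 * n}. x \<in> T I \<longleftrightarrow> I \<in> hits (2 * n) x ` \<A>"
    using ae by (subst distr)
  then have "AE x in ?P. \<forall>I\<in>Pow {..<2 * n}. \<pi> x \<in> T I \<longleftrightarrow> I \<in> hits (2 * n) (\<pi> x) ` \<A>"
    by (rule AE_distrD[rotated]) measurable
  then have *: "AE x in ?P. x \<in> T (swap_set n B I) \<longleftrightarrow> \<pi> x \<in> T I"
    using ae
  proof eventually_elim
    case (elim x)
    have hits: "hits (2 * n) (\<pi> x) A = swap_set n B (hits (2 * n) x A)" for A
      by (auto simp: hits_def \<pi>_def swap_set_def swap_pairs_less_iff)
    have sub: "swap_set n B J \<subseteq> {..<2 * n}" for J by (auto simp: swap_set_def)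
    have "\<pi> x \<in> T I \<longleftrightarrow> (\<exists>A\<in>\<A>. I = swap_set n B (hits (2 * n) x A))"
      using elim(1) I by (auto simp: hits image_iff)
    also have "\<dots> \<longleftrightarrow> (\<exists>A\<in>\<A>. swap_set n B I = hits (2 * n) x A)"
    proof -
      have "hits (2 * n) x A \<subseteq> {..<2 * n}" for A by (auto simp: hits_def)
      with I show ?thesis by (metis swap_set_invol)
    qed
    also have "\<dots> \<longleftrightarrow> x \<in> T (swap_set n B I)"
      using elim(2) sub by (auto simp: image_iff)
    finally show ?case by blast
  qed
  have "measure ?P (T I) = measure (distr ?P ?P \<pi>) (T I)" by (simp add: distr)
  also have "\<dots> = measure ?P (\<pi> -` T I \<inter> space ?P)" using T by (simp add: measure_distr)
  also have "\<dots> = measure ?P (T (swap_set n B I))"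
  proof (rule measure_eq_AE)
    show "AE x in ?P. x \<in> \<pi> -` T I \<inter> space ?P \<longleftrightarrow> x \<in> T (swap_set n B I)"
      using * AE_space by eventually_elim auto
    show "\<pi> -` T I \<inter> space ?P \<in> sets ?P" using T by measurable
  qed (rule T)
  finally show ?thesis by simp
qed

text \<open>An exponential Markov inequality summed over traces. The probability-weighted sum of
  \<open>exp (excess n I)\<close> does not change under any of the 2^n swaps, so it equals its
  average over them, and the average of each exponential is at most 1.\<close>

lemma excess_event_bound:
  assumes N: "prob_space N"
    and T: "\<And>I. T I \<in> sets (Pi\<^sub>M {..<2 * n} (\<lambda>_. N))"
    and ae: "AE x in Pi\<^sub>M {..<2 * n} (\<lambda>_. N). \<forall>I\<in>Pow {..<2 * n}. x \<in> T I \<longleftrightarrow> I \<in> hits (2 * n) x ` \<A>"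
  shows "measure (Pi\<^sub>M {..<2 * n} (\<lambda>_. N)) (\<Union>I\<in>{I\<in>Pow {..<2 * n}. t \<le> excess n I}. T I)
    \<le> exp (- t) * (\<Sum>I\<in>Pow {..<2 * n}. measure (Pi\<^sub>M {..<2 * n} (\<lambda>_. N)) (T I))"
proof -
  let ?P = "Pi\<^sub>M {..<2 * n} (\<lambda>_. N)"
  interpret P: prob_space ?P by (intro prob_space_PiM N)
  let ?p = "\<lambda>I. measure ?P (T I)"
  have "2 ^ n * (\<Sum>I\<in>Pow {..<2 * n}. ?p I * exp (excess n I))
      = (\<Sum>B\<in>Pow {..<n}. \<Sum>I\<in>Pow {..<2 * n}. ?p I * exp (excess n I))"
    by (simp add: card_Pow)
  also have "\<dots> = (\<Sum>B\<in>Pow {..<n}. \<Sum>I\<in>Pow {..<2 * n}. ?p I * exp (excess n (swap_set n B I)))"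
  proof (rule sum.cong[OF refl])
    fix B
    show "(\<Sum>I\<in>Pow {..<2 * n}. ?p I * exp (excess n I))
        = (\<Sum>I\<in>Pow {..<2 * n}. ?p I * exp (excess n (swap_set n B I)))"
      by (rule sum.reindex_bij_witness[of _ "swap_set n B" "swap_set n B"])
        (auto simp: swap_set_invol measure_swap_set[OF N T ae], auto simp: swap_set_def)
  qed
  also have "\<dots> = (\<Sum>I\<in>Pow {..<2 * n}. ?p I * (\<Sum>B\<in>Pow {..<n}. exp (excess n (swap_set n B I))))"
    unfolding sum_distrib_left by (rule sum.swap)
  also have "\<dots> \<le> (\<Sum>I\<in>Pow {..<2 * n}. ?p I * 2 ^ n)"
    by (intro sum_mono mult_left_mono sum_exp_excess_swap_le) auto
  finally have le: "(\<Sum>I\<in>Pow {..<2 * n}. ?p I * exp (excess n I)) \<le> (\<Sum>I\<in>Pow {..<2 * n}. ?p I)"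
    by (simp add: mult.commute flip: sum_distrib_left)
  have "measure ?P (\<Union>I\<in>{I\<in>Pow {..<2 * n}. t \<le> excess n I}. T I)
      \<le> (\<Sum>I\<in>{I\<in>Pow {..<2 * n}. t \<le> excess n I}. ?p I)"
    using T by (intro P.finite_measure_subadditive_finite) auto
  also have "\<dots> \<le> (\<Sum>I\<in>{I\<in>Pow {..<2 * n}. t \<le> excess n I}. exp (- t) * (?p I * exp (excess n I)))"
  proof (rule sum_mono)
    fix I assume "I \<in> {I\<in>Pow {..<2 * n}. t \<le> excess n I}"
    then have "1 \<le> exp (- t) * exp (excess n I)" by (simp flip: exp_add)
    then have "?p I * 1 \<le> ?p I * (exp (- t) * exp (excess n I))" by (intro mult_left_mono) auto
    then show "?p I \<le> exp (- t) * (?p I * exp (excess n I))" by (simp add: mult_ac)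
  qed
  also have "\<dots> \<le> (\<Sum>I\<in>Pow {..<2 * n}. exp (- t) * (?p I * exp (excess n I)))"
    by (intro sum_mono2) auto
  also have "\<dots> = exp (- t) * (\<Sum>I\<in>Pow {..<2 * n}. ?p I * exp (excess n I))"
    by (simp add: sum_distrib_left)
  also have "\<dots> \<le> exp (- t) * (\<Sum>I\<in>Pow {..<2 * n}. ?p I)"
    using le by (intro mult_left_mono) auto
  finally show ?thesis .
qed

text \<open>Lower-tail Chernoff bound with the weight 2 to the power minus the count: its mean is (1
  - p/2)^m \<le> exp (-\<mu>/2), where p is the measure of A, m the number of coordinates and \<mu>
  = m p. Symmetrization only asks that a ghost sample reach half its mean with probability
  1/2.\<close>

lemma prob_half_mean_le:
  assumes N: "prob_space N" and A: "A \<in> sets N" and J: "finite J"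
    and mean: "8 \<le> real (card J) * measure N A"
  shows "measure (Pi\<^sub>M J (\<lambda>_. N))
      {y \<in> space (Pi\<^sub>M J (\<lambda>_. N)). real (card {i\<in>J. y i \<in> A}) < real (card J) * measure N A / 2} \<le> 1/2"
proof -
  let ?P = "Pi\<^sub>M J (\<lambda>_. N)"
  interpret N: prob_space N by fact
  interpret product_sigma_finite "\<lambda>_. N" by standard
  interpret P: prob_space ?P by (intro prob_space_PiM N)
  define \<mu> where "\<mu> = real (card J) * measure N A"
  define h where "h y = (\<Prod>i\<in>J. ennreal (1 - indicator A (y i) / 2))" for y
  let ?E = "{y \<in> space ?P. real (card {i\<in>J. y i \<in> A}) < \<mu> / 2}"
  have h: "h y = ennreal ((1/2) ^ card {i\<in>J. y i \<in> A})" for y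
  proof -
    have "h y = ennreal (\<Prod>i\<in>J. 1 - indicator A (y i) / 2)"
      unfolding h_def by (intro prod_ennreal) (auto simp: indicator_def)
    also have "(\<Prod>i\<in>J. 1 - indicator A (y i) / 2) = (\<Prod>i\<in>J. if y i \<in> A then 1/2 else (1::real))"
      by (intro prod.cong) auto
    also have "\<dots> = (1/2) ^ card {i\<in>J. y i \<in> A}"
      using J by (simp add: prod.If_cases Int_def)
    finally show ?thesis .
  qed
  have hm [measurable]: "h \<in> borel_measurable ?P"
    unfolding h_def using A by measurable
  have "(\<integral>\<^sup>+y. h y \<partial>?P) = (\<Prod>i\<in>J. \<integral>\<^sup>+z. ennreal (1 - indicator A z / 2) \<partial>N)"
    unfolding h_def using A J by (intro product_nn_integral_prod) auto
  also have "(\<integral>\<^sup>+z. ennreal (1 - indicator A z / 2) \<partial>N) = ennreal (1 - measure N A / 2)"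
  proof -
    have ind: "integrable N (indicator A :: _ \<Rightarrow> real)"
      using A by (intro integrable_real_indicator) (auto simp: N.emeasure_eq_measure)
    then have "(\<integral>\<^sup>+z. ennreal (1 - indicator A z / 2) \<partial>N) = ennreal (\<integral>z. 1 - indicator A z / 2 \<partial>N)"
      by (intro nn_integral_eq_integral Bochner_Integration.integrable_diff
          integrable_divide_zero ind) (simp_all add: indicator_def)
    also have "(\<integral>z. 1 - indicator A z / 2 \<partial>N) = 1 - measure N A / 2"
      using A ind by (subst Bochner_Integration.integral_diff) (auto simp: N.prob_space)
    finally show ?thesis .
  qed
  also have "(\<Prod>i\<in>J. ennreal (1 - measure N A / 2)) = ennreal ((1 - measure N A / 2) ^ card J)"
    using N.prob_le_1[of A] by (simp only: prod_constant, subst ennreal_power) (linarith, simp)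
  also have "\<dots> \<le> ennreal (exp (- \<mu> / 2))"
  proof -
    have "(1 - measure N A / 2) ^ card J \<le> exp (- measure N A / 2) ^ card J"
      using N.prob_le_1[of A] exp_ge_add_one_self[of "- measure N A / 2"]
      by (intro power_mono) linarith+
    also have "\<dots> = exp (- \<mu> / 2)" by (simp add: \<mu>_def flip: exp_of_nat_mult)
    finally show ?thesis by (rule ennreal_leI)
  qed
  finally have int: "(\<integral>\<^sup>+y. h y \<partial>?P) \<le> ennreal (exp (- \<mu> / 2))" .
  have "emeasure ?P ?E \<le> emeasure ?P {y \<in> space ?P. 1 \<le> ennreal (2 powr (\<mu> / 2)) * h y}"
  proof (rule emeasure_mono)
    show "?E \<subseteq> {y \<in> space ?P. 1 \<le> ennreal (2 powr (\<mu> / 2)) * h y}"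
    proof (intro subsetI CollectI conjI)
      fix y assume y: "y \<in> ?E"
      have "1 \<le> 2 powr (\<mu> / 2 - real (card {i\<in>J. y i \<in> A}))"
        using y by (intro ge_one_powr_ge_zero) auto
      also have "\<dots> = 2 powr (\<mu> / 2) * (1/2) ^ card {i\<in>J. y i \<in> A}"
        by (simp add: powr_diff powr_realpow power_divide)
      finally have "ennreal 1 \<le> ennreal (2 powr (\<mu> / 2) * (1/2) ^ card {i\<in>J. y i \<in> A})"
        by (rule ennreal_leI)
      then show "1 \<le> ennreal (2 powr (\<mu> / 2)) * h y" by (simp add: h ennreal_mult)
    qed auto
  qed measurable
  also have "\<dots> \<le> ennreal (2 powr (\<mu> / 2)) * (\<integral>\<^sup>+y. h y * indicator (space ?P) y \<partial>?P)"
    by (intro nn_integral_Markov_inequality) auto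
  also have "(\<integral>\<^sup>+y. h y * indicator (space ?P) y \<partial>?P) = (\<integral>\<^sup>+y. h y \<partial>?P)"
    by (intro nn_integral_cong) auto
  also have "ennreal (2 powr (\<mu> / 2)) * (\<integral>\<^sup>+y. h y \<partial>?P) \<le> ennreal (2 powr (\<mu> / 2)) * ennreal (exp (- \<mu> / 2))"
    using int by (rule mult_left_mono) simp
  also have "\<dots> = ennreal (exp (- (1 - ln 2) * (\<mu> / 2)))"
    by (simp add: powr_def algebra_simps flip: ennreal_mult exp_add)
  also have "\<dots> \<le> ennreal (1/2)"
  proof (rule ennreal_leI)
    \<comment> \<open>As \<mu> \<ge> 8, the exponent (1 - ln 2) \<mu> / 2 is at least 0.3 * 4 = 1.2,
      which exceeds ln 2.\<close>
    have "ln 2 \<le> (0.7::real)"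
      using ln_2_less_1 ln2_le_25_over_36 by simp
    then have "0.3 * 4 \<le> (1 - ln 2) * (\<mu> / 2)"
      using mean by (intro mult_mono) (auto simp: \<mu>_def)
    with \<open>ln 2 \<le> 0.7\<close> have "ln 2 \<le> (1 - ln 2) * (\<mu> / 2)" by linarith
    then have "exp (- (1 - ln 2) * (\<mu> / 2)) \<le> exp (- ln (2::real))"
      by (simp only: exp_le_cancel_iff mult_minus_left neg_le_iff_le)
    then show "exp (- (1 - ln 2) * (\<mu> / 2)) \<le> 1 / 2" by (simp add: exp_minus)
  qed
  finally have "ennreal (measure ?P ?E) \<le> ennreal (1/2)" by (simp only: P.emeasure_eq_measure)
  then have "measure ?P ?E \<le> 1/2" by (subst (asm) ennreal_le_iff) auto
  then show ?thesis by (simp only: \<mu>_def)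
qed

text \<open>If A is under-represented in the sample, an independent ghost sample exposes this with
  probability at least 1/2 by making the excess of the trace at least t. Hence such samples have at
  most twice the probability of a large excess in the double sample, and the latter is at most exp
  (-t) times the expected number of traces, that is \<delta>/4.\<close>

lemma relative_deviation:
  fixes N :: "'a measure"
  assumes N: "prob_space N" and tm: "trace_measurable N \<A>" and vc: "has_vc_dim \<A> v"
    and n: "1 \<le> n" and \<delta>: "0 < \<delta>" "\<delta> < 1"
  obtains B where "B \<in> sets (Pi\<^sub>M {..<n} (\<lambda>_. N))" "measure (Pi\<^sub>M {..<n} (\<lambda>_. N)) B \<le> \<delta>"
    "\<And>x A. x \<in> space (Pi\<^sub>M {..<n} (\<lambda>_. N)) \<Longrightarrow> x \<notin> B \<Longrightarrow> A \<in> \<A> \<Longrightarrow> A \<in> sets N \<Longrightarrow>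
      8 * ln (4 * (2 * real n + 1) ^ v / \<delta>) \<le> real n * measure N A \<Longrightarrow>
      real n * measure N A / 16 \<le> real (card (hits n x A))"
proof -
  define t where "t = ln (4 * (2 * real n + 1) ^ v / \<delta>)"
  let ?I = "{..<n}" and ?J = "{n..<2 * n}"
  let ?P = "Pi\<^sub>M {..<2 * n} (\<lambda>_. N)" and ?X = "Pi\<^sub>M ?I (\<lambda>_. N)" and ?Y = "Pi\<^sub>M ?J (\<lambda>_. N)"
  interpret N: prob_space N by fact
  interpret PN: product_sigma_finite "\<lambda>_. N" by standard
  interpret P: prob_space ?P by (intro prob_space_PiM N)
  interpret X: prob_space ?X by (intro prob_space_PiM N)
  interpret Y: prob_space ?Y by (intro prob_space_PiM N)
  have IJ: "?I \<union> ?J = {..<2 * n}" by auto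
  define p where "p = (2 * real n + 1) ^ v"
  have p1: "1 \<le> p" unfolding p_def by (rule one_le_power) simp
  then have quot: "4 \<le> 4 * p / \<delta>" using \<delta> by (simp add: le_divide_eq)
  \<comment> \<open>This gives t \<ge> 1, so that a set with n P(A) \<ge> 8 t meets the requirement
    of mean at least 8 for the ghost sample.\<close>
  have "exp 1 \<le> 4 * p / \<delta>" using exp_le quot by linarith
  then have t1: "1 \<le> t"
    unfolding t_def p_def[symmetric] using quot by (subst ln_ge_iff) linarith+
  have expt: "exp (- t) * p = \<delta> / 4"
  proof -
    have "exp t = 4 * p / \<delta>" unfolding t_def p_def[symmetric] using quot by (intro exp_ln) linarith
    then show ?thesis using p1 \<delta> by (simp add: exp_minus)
  qed
  obtain T where T: "\<And>I. T I \<in> sets ?P"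
    "\<And>x A. x \<in> space ?P \<Longrightarrow> A \<in> \<A> \<Longrightarrow> x \<in> T (hits (2 * n) x A)"
    "AE x in ?P. \<forall>I\<in>Pow {..<2 * n}. x \<in> T I \<longleftrightarrow> I \<in> hits (2 * n) x ` \<A>"
    "(\<Sum>I\<in>Pow {..<2 * n}. emeasure ?P (T I)) \<le> ennreal ((real (2 * n) + 1) ^ v)"
    using trace_hull[OF N tm vc, of "2 * n"] by blast
  define D where "D = (\<Union>I\<in>{I\<in>Pow {..<2 * n}. t \<le> excess n I}. T I)"
  have D [measurable]: "D \<in> sets ?P" unfolding D_def using T(1) by (intro sets.finite_UN) auto
  have "(\<Sum>I\<in>Pow {..<2 * n}. measure ?P (T I)) \<le> p"
    unfolding p_def using T(4) by (simp add: P.emeasure_eq_measure sum_nonneg)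
  then have "measure ?P D \<le> exp (- t) * p"
    unfolding D_def by (intro order_trans[OF excess_event_bound[OF N T(1,3)]] mult_left_mono) auto
  then have mD: "measure ?P D \<le> \<delta> / 4" by (simp add: expt)
  have indicator_le: "indicator C y \<le> (1 :: ennreal)" for C :: "(nat \<Rightarrow> 'a) set" and y
    by (simp add: indicator_def)
  \<comment> \<open>The event that some member of the class is under-represented need not be measurable; it is
    enclosed in the set where the ghost sample detects it with probability at least 1/2.\<close>
  define f where "f x = (\<integral>\<^sup>+y. indicator D (merge ?I ?J (x, y)) \<partial>?Y)" for x
  have mm [measurable]: "merge ?I ?J \<in> measurable (?X \<Otimes>\<^sub>M ?Y) ?P"
    using measurable_merge[of ?I ?J "\<lambda>_. N"] by (simp add: IJ)
  have [measurable]: "f \<in> borel_measurable ?X"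
    unfolding f_def by measurable
  have "(\<integral>\<^sup>+x. f x \<partial>?X) = (\<integral>\<^sup>+z. indicator D z \<partial>?P)"
    unfolding f_def IJ[symmetric]
    by (rule PN.product_nn_integral_fold[symmetric]) (auto simp: IJ)
  also have "\<dots> = measure ?P D" by (simp add: P.emeasure_eq_measure)
  finally have intf: "(\<integral>\<^sup>+x. f x \<partial>?X) = measure ?P D" .
  define B where "B = {x \<in> space ?X. 1 \<le> 2 * f x}"
  have B [measurable]: "B \<in> sets ?X" unfolding B_def by measurable
  have "emeasure ?X B \<le> 2 * (\<integral>\<^sup>+x. f x * indicator (space ?X) x \<partial>?X)"
    unfolding B_def by (intro nn_integral_Markov_inequality) auto
  also have "(\<integral>\<^sup>+x. f x * indicator (space ?X) x \<partial>?X) = (\<integral>\<^sup>+x. f x \<partial>?X)"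
    by (intro nn_integral_cong) auto
  also have "2 * (\<integral>\<^sup>+x. f x \<partial>?X) = ennreal (2 * measure ?P D)"
    by (simp add: intf ennreal_mult)
  finally have "measure ?X B \<le> 2 * measure ?P D"
    by (simp add: X.emeasure_eq_measure)
  with mD \<delta> have "measure ?X B \<le> \<delta>" by simp
  moreover have "real n * measure N A / 16 \<le> real (card (hits n x A))"
    if x: "x \<in> space ?X" "x \<notin> B" and A: "A \<in> \<A>" "A \<in> sets N" and large: "8 * t \<le> real n * measure N A"
    for x A
  proof (rule ccontr)
    assume "\<not> ?thesis"
    then have few: "real (card (hits n x A)) < real n * measure N A / 16" by simp
    let ?F = "{y \<in> space ?Y. real (card {i\<in>?J. y i \<in> A}) < real (card ?J) * measure N A / 2}"
    have F [measurable]: "?F \<in> sets ?Y"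
    proof -
      have eq: "(\<Sum>i\<in>?J. indicator A (y i)) = real (card {i\<in>?J. y i \<in> A})" for y
        by (simp add: indicator_def of_bool_def sum.If_cases Int_def)
      have "(\<lambda>y. (\<Sum>i\<in>?J. indicator A (y i)) :: real) \<in> borel_measurable ?Y"
        using A(2) by measurable
      then have "(\<lambda>y. real (card {i\<in>?J. y i \<in> A})) \<in> borel_measurable ?Y"
        unfolding eq .
      then show ?thesis by (rule borel_measurable_less) (rule borel_measurable_const)
    qed
    have "measure ?Y ?F \<le> 1 / 2"
      using large t1 A by (intro prob_half_mean_le[OF N]) auto
    moreover have "measure ?Y (space ?Y - ?F) = 1 - measure ?Y ?F"
      using F by (rule Y.prob_compl)
    ultimately have "1 / 2 \<le> measure ?Y (space ?Y - ?F)" by linarith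
    then have "ennreal (1 / 2) \<le> emeasure ?Y (space ?Y - ?F)"
      unfolding Y.emeasure_eq_measure by (rule ennreal_leI)
    also have "\<dots> = (\<integral>\<^sup>+y. indicator (space ?Y - ?F) y \<partial>?Y)"
      using F by (intro nn_integral_indicator[symmetric] sets.compl_sets)
    also have "\<dots> \<le> f x"
      unfolding f_def
    proof (rule nn_integral_mono)
      fix y assume y: "y \<in> space ?Y"
      show "indicator (space ?Y - ?F) y \<le> (indicator D (merge ?I ?J (x, y)) :: ennreal)"
      proof (cases "y \<in> ?F")
        case False
        let ?z = "merge ?I ?J (x, y)" and ?H = "hits (2 * n) (merge ?I ?J (x, y)) A"
        have "(x, y) \<in> space (?X \<Otimes>\<^sub>M ?Y)" using x(1) y by (simp add: space_pair_measure)
        then have "?z \<in> space ?P" by (rule measurable_space[OF mm])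
        then have zT: "?z \<in> T ?H" using A(1) by (rule T(2))
        \<comment> \<open>The constants 8 and 16 are matched here: with q = n P(A), the ghost count
          is at least q/2 and the sample count below q/16, so the excess exceeds q/4 - q/8 = q/8
          \<ge> t.\<close>
        have exc: "t \<le> excess n ?H"
        proof -
          have "?H \<inter> ?J = {i\<in>?J. y i \<in> A}" "?H \<inter> ?I = hits n x A"
            by (auto simp: hits_def merge_def)
          then have "excess n ?H = real (card {i\<in>?J. y i \<in> A}) / 2 - 2 * real (card (hits n x A))"
            by (simp add: excess_def)
          moreover have "real n * measure N A / 2 \<le> real (card {i\<in>?J. y i \<in> A})"
            using False y by auto
          ultimately show ?thesis using few large by linarith
        qed
        have "?H \<in> Pow {..<2 * n}" by (auto simp: hits_def)
        with exc have "?H \<in> {I\<in>Pow {..<2 * n}. t \<le> excess n I}" by (intro CollectI conjI)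
        then have "?z \<in> D" unfolding D_def using zT by (rule UN_I)
        then have "(indicator D ?z :: ennreal) = 1" by (rule indicator_simps)
        then show ?thesis by (simp only: indicator_le)
      next
        case True
        then show ?thesis by (simp only: indicator_def Diff_iff not_True_eq_False simp_thms of_bool_eq zero_le)
      qed
    qed
    finally have half: "ennreal (1 / 2) \<le> f x" .
    have "(1::ennreal) = ennreal (2 * (1 / 2))" by simp
    also have "\<dots> = ennreal 2 * ennreal (1 / 2)" by (rule ennreal_mult) auto
    also have "\<dots> \<le> ennreal 2 * f x" using half by (rule mult_left_mono) (rule zero_le)
    finally have "1 \<le> 2 * f x" by (simp only: ennreal_numeral)
    with x(1) have "x \<in> B" unfolding B_def by (intro CollectI conjI)
    with x(2) show False by (rule notE)
  qed
  ultimately show ?thesis unfolding t_def by (rule that[OF B])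
qed

section \<open>Sub-Gaussian noise over a trace class\<close>

text \<open>The premise \<open>weight\<close> says, in integrated form, that the conditional
  expectation of \<phi> given p is at most c. Since h sees each coordinate only through p, the
  factors \<phi> can be integrated out one coordinate at a time, each costing a factor c. Working
  with integrals avoids conditional expectations on the product space.\<close>

lemma nn_integral_PiM_weight_le:
  assumes Q: "prob_space Q" and J: "finite J" and I: "I \<subseteq> J"
    and p [measurable]: "p \<in> measurable Q N" and \<phi> [measurable]: "\<phi> \<in> borel_measurable Q"
    and weight: "\<And>f. f \<in> borel_measurable N \<Longrightarrow>
      (\<integral>\<^sup>+q. f (p q) * \<phi> q \<partial>Q) \<le> c * (\<integral>\<^sup>+q. f (p q) \<partial>Q)"
    and h [measurable]: "h \<in> borel_measurable (Pi\<^sub>M J (\<lambda>_. N))"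
  shows "(\<integral>\<^sup>+z. h (\<lambda>i\<in>J. p (z i)) * (\<Prod>i\<in>I. \<phi> (z i)) \<partial>Pi\<^sub>M J (\<lambda>_. Q))
    \<le> c ^ card I * (\<integral>\<^sup>+z. h (\<lambda>i\<in>J. p (z i)) \<partial>Pi\<^sub>M J (\<lambda>_. Q))"
proof -
  interpret Q: prob_space Q by fact
  interpret product_sigma_finite "\<lambda>_. Q" by standard
  have "finite I" using I J by (rule finite_subset)
  then show ?thesis using I
  proof (induction I rule: finite_induct)
    case empty
    show ?case by simp
  next
    case (insert j I)
    define K where "K = J - {j}"
    have JK: "J = insert j K" and jK: "j \<notin> K" and K: "finite K" and IK: "I \<subseteq> K"
      using insert.prems insert.hyps(2) J by (auto simp: K_def)
    have \<pi> [measurable]: "(\<lambda>z. \<lambda>i\<in>J. p (z i)) \<in> measurable (Pi\<^sub>M J (\<lambda>_. Q)) (Pi\<^sub>M J (\<lambda>_. N))"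
      by measurable
    have prodm: "(\<lambda>z. \<Prod>i\<in>I'. \<phi> (z i)) \<in> borel_measurable (Pi\<^sub>M J (\<lambda>_. Q))" if "I' \<subseteq> J" for I'
    proof (rule borel_measurable_prod_ennreal)
      fix i assume "i \<in> I'"
      with that have [simp]: "i \<in> J" by blast
      show "(\<lambda>z. \<phi> (z i)) \<in> borel_measurable (Pi\<^sub>M J (\<lambda>_. Q))" by measurable
    qed
    have IJ: "I \<subseteq> J" "insert j I \<subseteq> J" using insert.prems by auto
    let ?F = "\<lambda>I z. h (\<lambda>i\<in>J. p (z i)) * (\<Prod>i\<in>I. \<phi> (z i))"
    have F: "?F I' \<in> borel_measurable (Pi\<^sub>M (insert j K) (\<lambda>_. Q))" if "I' \<subseteq> J" for I'
      unfolding JK[symmetric] using prodm[OF that] by measurable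
    have upd: "(\<Prod>i\<in>I. \<phi> ((z(j := q)) i)) = (\<Prod>i\<in>I. \<phi> (z i))" for z q
      using insert.hyps(2) by (intro prod.cong) auto
    have "(\<integral>\<^sup>+z. ?F (insert j I) z \<partial>Pi\<^sub>M J (\<lambda>_. Q))
        = (\<integral>\<^sup>+z. \<integral>\<^sup>+q. ?F (insert j I) (z(j := q)) \<partial>Q \<partial>Pi\<^sub>M K (\<lambda>_. Q))"
      unfolding JK by (rule product_nn_integral_insert[OF K jK F[OF IJ(2), unfolded JK]])
    also have "\<dots> \<le> (\<integral>\<^sup>+z. c * (\<integral>\<^sup>+q. ?F I (z(j := q)) \<partial>Q) \<partial>Pi\<^sub>M K (\<lambda>_. Q))"
    proof (rule nn_integral_mono)
      fix z assume z: "z \<in> space (Pi\<^sub>M K (\<lambda>_. Q))"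
      \<comment> \<open>With the other coordinates frozen at z, the integrand without the weight of
        j depends on the j-th coordinate q only through \<open>p q\<close>, as \<open>weight\<close>
        requires.\<close>
      define f where "f x = h (\<lambda>i\<in>J. if i = j then x else p (z i)) * (\<Prod>i\<in>I. \<phi> (z i))" for x
      have "(\<lambda>x. \<lambda>i\<in>J. if i = j then x else p (z i)) \<in> measurable N (Pi\<^sub>M J (\<lambda>_. N))"
      proof (rule measurable_restrict)
        fix i assume i: "i \<in> J"
        show "(\<lambda>x. if i = j then x else p (z i)) \<in> measurable N N"
        proof (cases "i = j")
          case False
          then have "z i \<in> space Q" using z i by (auto simp: space_PiM K_def)
          then have "p (z i) \<in> space N" by (rule measurable_space[OF p])
          then show ?thesis using False by simp
        qed simp
      qed
      then have fm: "f \<in> borel_measurable N" unfolding f_def by measurable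
      have arg: "(\<lambda>i\<in>J. p ((z(j := q)) i)) = (\<lambda>i\<in>J. if i = j then p q else p (z i))" for q
        by (auto simp: fun_eq_iff)
      have "(\<integral>\<^sup>+q. ?F (insert j I) (z(j := q)) \<partial>Q) = (\<integral>\<^sup>+q. f (p q) * \<phi> q \<partial>Q)"
        unfolding f_def arg by (simp only: prod.insert[OF insert.hyps] upd fun_upd_same mult_ac)
      also have "\<dots> \<le> c * (\<integral>\<^sup>+q. f (p q) \<partial>Q)" by (rule weight[OF fm])
      also have "(\<integral>\<^sup>+q. f (p q) \<partial>Q) = (\<integral>\<^sup>+q. ?F I (z(j := q)) \<partial>Q)"
        unfolding f_def arg upd ..
      finally show "(\<integral>\<^sup>+q. ?F (insert j I) (z(j := q)) \<partial>Q) \<le> c * (\<integral>\<^sup>+q. ?F I (z(j := q)) \<partial>Q)" .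
    qed
    also have "\<dots> = c * (\<integral>\<^sup>+z. (\<integral>\<^sup>+q. ?F I (z(j := q)) \<partial>Q) \<partial>Pi\<^sub>M K (\<lambda>_. Q))"
    proof (rule nn_integral_cmult)
      have [measurable]: "?F I \<in> borel_measurable (Pi\<^sub>M (insert j K) (\<lambda>_. Q))" by (rule F[OF IJ(1)])
      have "(\<lambda>(z, q). ?F I (z(j := q))) \<in> borel_measurable (Pi\<^sub>M K (\<lambda>_. Q) \<Otimes>\<^sub>M Q)"
        using measurable_compose[OF measurable_add_dim F[OF IJ(1)]] by (simp add: case_prod_unfold)
      then show "(\<lambda>z. \<integral>\<^sup>+q. ?F I (z(j := q)) \<partial>Q) \<in> borel_measurable (Pi\<^sub>M K (\<lambda>_. Q))"
        by (rule Q.borel_measurable_nn_integral)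
    qed
    also have "(\<integral>\<^sup>+z. (\<integral>\<^sup>+q. ?F I (z(j := q)) \<partial>Q) \<partial>Pi\<^sub>M K (\<lambda>_. Q)) = (\<integral>\<^sup>+z. ?F I z \<partial>Pi\<^sub>M J (\<lambda>_. Q))"
      unfolding JK by (rule product_nn_integral_insert[OF K jK F[OF IJ(1), unfolded JK], symmetric])
    also have "c * (\<integral>\<^sup>+z. ?F I z \<partial>Pi\<^sub>M J (\<lambda>_. Q))
        \<le> c * (c ^ card I * (\<integral>\<^sup>+z. h (\<lambda>i\<in>J. p (z i)) \<partial>Pi\<^sub>M J (\<lambda>_. Q)))"
      by (rule mult_left_mono[OF insert.IH[OF IJ(1)]]) (rule zero_le)
    finally show ?case
      by (simp only: card_insert_disjoint[OF insert.hyps] power_Suc mult.assoc)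
  qed
qed

text \<open>Exponential Markov inequality restricted to the event that the design lies in T. Taking
  the indicator of T for h keeps its probability as a factor, which makes the bounds summable over
  traces.\<close>

lemma chernoff_given_trace:
  assumes Q: "prob_space Q" and J: "finite J" and I: "I \<subseteq> J"
    and p [measurable]: "p \<in> measurable Q N" and e [measurable]: "e \<in> borel_measurable Q"
    and subg: "\<And>f. f \<in> borel_measurable N \<Longrightarrow>
      (\<integral>\<^sup>+q. f (p q) * ennreal (exp (t * e q)) \<partial>Q) \<le> ennreal (exp (t\<^sup>2 * s / 2)) * (\<integral>\<^sup>+q. f (p q) \<partial>Q)"
    and T [measurable]: "T \<in> sets (Pi\<^sub>M J (\<lambda>_. N))" and t: "0 \<le> t"
  shows "measure (Pi\<^sub>M J (\<lambda>_. Q))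
      {z \<in> space (Pi\<^sub>M J (\<lambda>_. Q)). (\<lambda>i\<in>J. p (z i)) \<in> T \<and> u < (\<Sum>i\<in>I. e (z i))}
    \<le> exp (t\<^sup>2 * (s * real (card I)) / 2 - t * u)
        * measure (Pi\<^sub>M J (\<lambda>_. Q)) {z \<in> space (Pi\<^sub>M J (\<lambda>_. Q)). (\<lambda>i\<in>J. p (z i)) \<in> T}"
proof -
  let ?P = "Pi\<^sub>M J (\<lambda>_. Q)"
  interpret P: prob_space ?P by (intro prob_space_PiM Q)
  define S where "S z = (\<Sum>i\<in>I. e (z i))" for z
  define \<pi> where "\<pi> z = (\<lambda>i\<in>J. p (z i))" for z
  have [measurable]: "\<pi> \<in> measurable ?P (Pi\<^sub>M J (\<lambda>_. N))"
    unfolding \<pi>_def by measurable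
  have [measurable]: "S \<in> borel_measurable ?P"
    unfolding S_def
  proof (rule borel_measurable_sum)
    fix i assume "i \<in> I"
    with I have [simp]: "i \<in> J" by blast
    show "(\<lambda>z. e (z i)) \<in> borel_measurable ?P" by measurable
  qed
  define u' where "u' z = (indicator T (\<pi> z) :: ennreal) * ennreal (exp (t * S z))" for z
  let ?E = "{z \<in> space ?P. \<pi> z \<in> T}"
  have "(\<integral>\<^sup>+z. u' z \<partial>?P) = (\<integral>\<^sup>+z. indicator T (\<lambda>i\<in>J. p (z i)) * (\<Prod>i\<in>I. ennreal (exp (t * e (z i)))) \<partial>?P)"
  proof (rule nn_integral_cong)
    fix z
    have "exp (t * S z) = (\<Prod>i\<in>I. exp (t * e (z i)))"
      unfolding S_def sum_distrib_left using I J finite_subset by (intro exp_sum) auto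
    then show "u' z = indicator T (\<lambda>i\<in>J. p (z i)) * (\<Prod>i\<in>I. ennreal (exp (t * e (z i))))"
      unfolding u'_def \<pi>_def by (simp add: prod_ennreal)
  qed
  also have "\<dots> \<le> ennreal (exp (t\<^sup>2 * s / 2)) ^ card I * (\<integral>\<^sup>+z. indicator T (\<lambda>i\<in>J. p (z i)) \<partial>?P)"
    by (rule nn_integral_PiM_weight_le[OF Q J I p _ subg borel_measurable_indicator[OF T]]) measurable
  also have "(\<integral>\<^sup>+z. indicator T (\<lambda>i\<in>J. p (z i)) \<partial>?P) = (\<integral>\<^sup>+z. indicator ?E z \<partial>?P)"
    by (intro nn_integral_cong) (simp add: indicator_def \<pi>_def)
  also have "\<dots> = ennreal (measure ?P ?E)"
    by (subst nn_integral_indicator) (measurable, simp only: P.emeasure_eq_measure)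
  also have "ennreal (exp (t\<^sup>2 * s / 2)) ^ card I = ennreal (exp (t\<^sup>2 * (s * real (card I)) / 2))"
    by (simp add: ennreal_power mult_ac flip: exp_of_nat_mult)
  finally have int: "(\<integral>\<^sup>+z. u' z \<partial>?P)
    \<le> ennreal (exp (t\<^sup>2 * (s * real (card I)) / 2)) * ennreal (measure ?P ?E)" .
  let ?D = "{z \<in> space ?P. \<pi> z \<in> T \<and> u < S z}"
  have "emeasure ?P ?D \<le> emeasure ?P {z \<in> space ?P. 1 \<le> ennreal (exp (- t * u)) * u' z}"
  proof (rule emeasure_mono)
    show "?D \<subseteq> {z \<in> space ?P. 1 \<le> ennreal (exp (- t * u)) * u' z}"
    proof
      fix z assume z: "z \<in> ?D"
      then have "0 \<le> - t * u + t * S z" using t by (simp add: mult_left_mono)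
      then have "1 \<le> exp (- t * u) * exp (t * S z)" by (simp flip: exp_add)
      then have "ennreal 1 \<le> ennreal (exp (- t * u) * exp (t * S z))" by (rule ennreal_leI)
      also have "\<dots> = ennreal (exp (- t * u)) * u' z"
        using z by (simp add: u'_def ennreal_mult)
      finally show "z \<in> {z \<in> space ?P. 1 \<le> ennreal (exp (- t * u)) * u' z}"
        using z by simp
    qed
    show "{z \<in> space ?P. 1 \<le> ennreal (exp (- t * u)) * u' z} \<in> sets ?P"
      unfolding u'_def by measurable
  qed
  also have "\<dots> \<le> ennreal (exp (- t * u)) * (\<integral>\<^sup>+z. u' z * indicator (space ?P) z \<partial>?P)"
    by (rule nn_integral_Markov_inequality) (unfold u'_def, measurable)
  also have "(\<integral>\<^sup>+z. u' z * indicator (space ?P) z \<partial>?P) = (\<integral>\<^sup>+z. u' z \<partial>?P)"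
    by (intro nn_integral_cong) simp
  also have "ennreal (exp (- t * u)) * (\<integral>\<^sup>+z. u' z \<partial>?P) \<le> ennreal (exp (- t * u)) *
      (ennreal (exp (t\<^sup>2 * (s * real (card I)) / 2)) * ennreal (measure ?P ?E))"
    by (rule mult_left_mono[OF int]) (rule zero_le)
  also have "\<dots> = ennreal (exp (t\<^sup>2 * (s * real (card I)) / 2 - t * u) * measure ?P ?E)"
  proof -
    have "exp (t\<^sup>2 * (s * real (card I)) / 2 - t * u) = exp (- t * u) * exp (t\<^sup>2 * (s * real (card I)) / 2)"
      by (simp flip: exp_add)
    then show ?thesis by (simp add: ennreal_mult mult.assoc)
  qed
  finally have "ennreal (measure ?P ?D) \<le> ennreal (exp (t\<^sup>2 * (s * real (card I)) / 2 - t * u) * measure ?P ?E)"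
    by (simp only: P.emeasure_eq_measure)
  then have "measure ?P ?D \<le> exp (t\<^sup>2 * (s * real (card I)) / 2 - t * u) * measure ?P ?E"
    by (subst (asm) ennreal_le_iff) simp_all
  then show ?thesis unfolding \<pi>_def S_def .
qed

text \<open>The Chernoff bound optimized in t. The variance proxy w is s times the number of
  summands, which is fixed because I is fixed; this lets the final noise bound scale with the random
  count of sample points.\<close>

lemma subgaussian_tail_given_trace:
  assumes Q: "prob_space Q" and J: "finite J" and I: "I \<subseteq> J"
    and p [measurable]: "p \<in> measurable Q N" and e [measurable]: "e \<in> borel_measurable Q"
    and subg: "\<And>t f. f \<in> borel_measurable N \<Longrightarrow>
      (\<integral>\<^sup>+q. f (p q) * ennreal (exp (t * e q)) \<partial>Q) \<le> ennreal (exp (t\<^sup>2 * s / 2)) * (\<integral>\<^sup>+q. f (p q) \<partial>Q)"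
    and T [measurable]: "T \<in> sets (Pi\<^sub>M J (\<lambda>_. N))" and s: "0 \<le> s" and k: "0 \<le> k"
  shows "measure (Pi\<^sub>M J (\<lambda>_. Q)) {z \<in> space (Pi\<^sub>M J (\<lambda>_. Q)).
        (\<lambda>i\<in>J. p (z i)) \<in> T \<and> sqrt (2 * (s * real (card I)) * k) < (\<Sum>i\<in>I. e (z i))}
    \<le> exp (- k) * measure (Pi\<^sub>M J (\<lambda>_. Q)) {z \<in> space (Pi\<^sub>M J (\<lambda>_. Q)). (\<lambda>i\<in>J. p (z i)) \<in> T}"
proof -
  let ?P = "Pi\<^sub>M J (\<lambda>_. Q)"
  interpret P: prob_space ?P by (intro prob_space_PiM Q)
  define w where "w = s * real (card I)"
  have w: "0 \<le> w" using s by (simp add: w_def)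
  define m where "m = measure ?P {z \<in> space ?P. (\<lambda>i\<in>J. p (z i)) \<in> T}"
  define D where "D u = {z \<in> space ?P. (\<lambda>i\<in>J. p (z i)) \<in> T \<and> u < (\<Sum>i\<in>I. e (z i))}" for u
  have chernoff: "measure ?P (D u) \<le> exp (t\<^sup>2 * w / 2 - t * u) * m" if "0 \<le> t" for t u
    unfolding D_def w_def m_def by (rule chernoff_given_trace[OF Q J I p e subg T that])
  have Im: "(\<lambda>z. \<Sum>i\<in>I. e (z i)) \<in> borel_measurable ?P"
  proof (rule borel_measurable_sum)
    fix i assume "i \<in> I"
    with I have [simp]: "i \<in> J" by blast
    show "(\<lambda>z. e (z i)) \<in> borel_measurable ?P" by measurable
  qed
  have Dm: "D u \<in> sets ?P" for u
    unfolding D_def using Im by measurable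
  have "measure ?P (D (sqrt (2 * w * k))) \<le> exp (- k) * m"
  proof (cases "w = 0")
    case False
    with w have w0: "0 < w" by simp
    define t where "t = sqrt (2 * k / w)"
    have "t * sqrt (2 * w * k) = sqrt ((2 * k)\<^sup>2)"
      unfolding t_def using w0 by (simp add: power2_eq_square mult_ac flip: real_sqrt_mult)
    then have tu: "t * sqrt (2 * w * k) = 2 * k" unfolding real_sqrt_abs using k by simp
    have t2: "t\<^sup>2 * w / 2 = k" unfolding t_def using w0 k by simp
    have "0 \<le> t" unfolding t_def using w0 k by simp
    from chernoff[OF this, of "sqrt (2 * w * k)"] show ?thesis by (simp add: tu t2)
  next
    case True
    \<comment> \<open>No finite \<open>t\<close> is optimal for degenerate noise; letting \<open>t\<close> tend to infinity shows that the sum is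
      almost surely not positive.\<close>
    have null: "D (1 / Suc i) \<in> null_sets ?P" for i
    proof -
      have "measure ?P (D (1 / Suc i)) = 0"
      proof (rule ccontr)
        assume "measure ?P (D (1 / Suc i)) \<noteq> 0"
        then have pos: "0 < measure ?P (D (1 / Suc i))" by (simp add: zero_less_measure_iff)
        \<comment> \<open>Chosen so that the bound \<open>exp (- t / Suc i)\<close> equals the
          supposed positive probability divided by exp 1, a contradiction.\<close>
        define t where "t = Suc i * (1 - ln (measure ?P (D (1 / Suc i))))"
        have "ln (measure ?P (D (1 / Suc i))) \<le> 0"
          using pos P.prob_le_1 by (subst ln_le_zero_iff)
        then have t: "0 \<le> t" unfolding t_def by (intro mult_nonneg_nonneg) auto
        have "measure ?P (D (1 / Suc i)) \<le> exp (t\<^sup>2 * w / 2 - t * (1 / Suc i)) * m"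
          by (rule chernoff[OF t])
        also have "\<dots> \<le> exp (t\<^sup>2 * w / 2 - t * (1 / Suc i)) * 1"
          by (intro mult_left_mono) (auto simp: m_def)
        also have "t\<^sup>2 * w / 2 - t * (1 / Suc i) = ln (measure ?P (D (1 / Suc i))) - 1"
          by (simp add: True t_def)
        also have "exp (ln (measure ?P (D (1 / Suc i))) - 1) * 1 = measure ?P (D (1 / Suc i)) / exp 1"
          using pos by (simp add: exp_diff)
        finally have "measure ?P (D (1 / Suc i)) * exp 1 \<le> measure ?P (D (1 / Suc i))"
          by (simp add: field_simps)
        then show False using pos by (simp add: mult_le_cancel_left1)
      qed
      then show ?thesis using Dm by (simp add: null_sets_def P.emeasure_eq_measure)
    qed
    \<comment> \<open>For w = 0 the threshold is 0, and exceeding it strictly means exceeding some 1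
      / (i + 1).\<close>
    have "D 0 = (\<Union>i. D (1 / Suc i))"
    proof (intro equalityI subsetI)
      fix z assume z: "z \<in> D 0"
      then have "0 < (\<Sum>i\<in>I. e (z i))" by (simp add: D_def)
      then obtain i where "1 / Suc i < (\<Sum>i\<in>I. e (z i))"
        by (rule nat_approx_posE)
      with z show "z \<in> (\<Union>i. D (1 / Suc i))" unfolding D_def by blast
    next
      fix z assume "z \<in> (\<Union>i. D (1 / Suc i))"
      then obtain i where i: "z \<in> D (1 / Suc i)" by blast
      have "0 < 1 / real (Suc i)" by simp
      with i show "z \<in> D 0" unfolding D_def mem_Collect_eq by (meson less_trans)
    qed
    moreover have "(\<Union>i. D (1 / Suc i)) \<in> null_sets ?P"
      using null by (rule null_sets_UN)
    ultimately have "measure ?P (D 0) = 0"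
      by (simp add: measure_eq_0_null_sets)
    then show ?thesis by (simp add: True m_def)
  qed
  then show ?thesis unfolding D_def w_def m_def .
qed

lemma distr_PiM_pointwise:
  assumes Q: "prob_space Q" and p: "p \<in> measurable Q N" and N: "distr Q N p = N" and J: "finite J"
  shows "distr (Pi\<^sub>M J (\<lambda>_. Q)) (Pi\<^sub>M J (\<lambda>_. N)) (\<lambda>z. \<lambda>i\<in>J. p (z i)) = Pi\<^sub>M J (\<lambda>_. N)"
proof -
  have psN: "prob_space N" using prob_space.prob_space_distr[OF Q p] by (simp add: N)
  have "distr (Pi\<^sub>M J (\<lambda>_. Q)) (Pi\<^sub>M J (\<lambda>_. N)) (compose J p) = Pi\<^sub>M J (\<lambda>i. distr Q N p)"
    by (rule distr_PiM_finite_prob_space'[OF J Q psN p])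
  moreover have "compose J p = (\<lambda>z. \<lambda>i\<in>J. p (z i))" by (auto simp: fun_eq_iff compose_def)
  ultimately show ?thesis by (simp only: N)
qed

text \<open>On the hull of the trace I both one-sided tails cost exp (-k) times the probability of
  the hull. Summed over I this is at most 2 exp (-k) (n + 1)^v, and k is the logarithm for which it
  equals \<delta>. The random threshold in the conclusion is harmless because it is a constant on
  each trace event.\<close>

lemma uniform_noise_bound:
  assumes Q: "prob_space Q" and p [measurable]: "p \<in> measurable Q N" and N: "distr Q N p = N"
    and e [measurable]: "e \<in> borel_measurable Q"
    and subg: "\<And>t f. f \<in> borel_measurable N \<Longrightarrow>
      (\<integral>\<^sup>+q. f (p q) * ennreal (exp (t * e q)) \<partial>Q) \<le> ennreal (exp (t\<^sup>2 * s / 2)) * (\<integral>\<^sup>+q. f (p q) \<partial>Q)"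
    and s: "0 \<le> s" and tm: "trace_measurable N \<A>" and vc: "has_vc_dim \<A> v" and \<delta>: "0 < \<delta>" "\<delta> < 1"
  obtains B where "B \<in> sets (Pi\<^sub>M {..<n} (\<lambda>_. Q))" "measure (Pi\<^sub>M {..<n} (\<lambda>_. Q)) B \<le> \<delta>"
    "\<And>z A. z \<in> space (Pi\<^sub>M {..<n} (\<lambda>_. Q)) \<Longrightarrow> z \<notin> B \<Longrightarrow> A \<in> \<A> \<Longrightarrow>
      \<bar>\<Sum>i\<in>hits n (\<lambda>i. p (z i)) A. e (z i)\<bar>
        \<le> sqrt (2 * (s * real (card (hits n (\<lambda>i. p (z i)) A))) * ln (2 * (real n + 1) ^ v / \<delta>))"
proof -
  let ?J = "{..<n}"
  let ?P = "Pi\<^sub>M ?J (\<lambda>_. Q)" and ?X = "Pi\<^sub>M ?J (\<lambda>_. N)"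
  define \<pi> where "\<pi> z = (\<lambda>i\<in>?J. p (z i))" for z
  define k where "k = ln (2 * (real n + 1) ^ v / \<delta>)"
  define r where "r = (real n + 1) ^ v"
  interpret P: prob_space ?P by (intro prob_space_PiM Q)
  have psN: "prob_space N" using prob_space.prob_space_distr[OF Q p] by (simp add: N)
  interpret X: prob_space ?X by (intro prob_space_PiM psN)
  have r1: "1 \<le> r" unfolding r_def by (rule one_le_power) simp
  then have quot: "1 \<le> 2 * r / \<delta>" using \<delta> by (simp add: le_divide_eq)
  then have k0: "0 \<le> k" unfolding k_def r_def[symmetric] by (rule ln_ge_zero)
  have expk: "2 * exp (- k) * r = \<delta>"
  proof -
    have "exp k = 2 * r / \<delta>" unfolding k_def r_def[symmetric] using quot by (intro exp_ln) linarith
    then show ?thesis using r1 \<delta> by (simp add: exp_minus)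
  qed
  have \<pi> [measurable]: "\<pi> \<in> measurable ?P ?X" unfolding \<pi>_def by measurable
  have distr\<pi>: "distr ?P ?X \<pi> = ?X"
    unfolding \<pi>_def by (rule distr_PiM_pointwise[OF Q p N]) simp
  obtain T where T: "\<And>I. T I \<in> sets ?X"
    "\<And>x A. x \<in> space ?X \<Longrightarrow> A \<in> \<A> \<Longrightarrow> x \<in> T (hits n x A)"
    "AE x in ?X. \<forall>I\<in>Pow ?J. x \<in> T I \<longleftrightarrow> I \<in> hits n x ` \<A>"
    "(\<Sum>I\<in>Pow ?J. emeasure ?X (T I)) \<le> ennreal ((real n + 1) ^ v)"
    using trace_hull[OF psN tm vc, of n] by blast
  have mT: "measure ?P {z \<in> space ?P. \<pi> z \<in> T I} = measure ?X (T I)" for I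
  proof -
    have "measure ?X (T I) = measure (distr ?P ?X \<pi>) (T I)" by (simp only: distr\<pi>)
    also have "\<dots> = measure ?P (\<pi> -` T I \<inter> space ?P)" by (rule measure_distr[OF \<pi> T(1)])
    also have "\<pi> -` T I \<inter> space ?P = {z \<in> space ?P. \<pi> z \<in> T I}" by blast
    finally show ?thesis by simp
  qed
  define c where "c I = sqrt (2 * (s * real (card I)) * k)" for I :: "nat set"
  define S where "S I z = (\<Sum>i\<in>I. e (z i))" for I :: "nat set" and z
  define U where "U I = {z \<in> space ?P. \<pi> z \<in> T I \<and> c I < S I z}" for I
  define L where "L I = {z \<in> space ?P. \<pi> z \<in> T I \<and> c I < (\<Sum>i\<in>I. - e (z i))}" for I
  define B where "B = (\<Union>I\<in>Pow ?J. U I \<union> L I)"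
  have Sm: "S I \<in> borel_measurable ?P" if "I \<subseteq> ?J" for I
    unfolding S_def
  proof (rule borel_measurable_sum)
    fix i assume "i \<in> I"
    with that have [simp]: "i < n" by blast
    show "(\<lambda>z. e (z i)) \<in> borel_measurable ?P" by measurable
  qed
  have meas: "U I \<in> sets ?P" "L I \<in> sets ?P" if "I \<subseteq> ?J" for I
    using Sm[OF that] T(1)[of I] unfolding U_def L_def sum_negf S_def[symmetric] by measurable
  have U: "measure ?P (U I) \<le> exp (- k) * measure ?X (T I)" if "I \<subseteq> ?J" for I
    unfolding U_def c_def S_def mT[symmetric] \<pi>_def
    by (rule subgaussian_tail_given_trace[OF Q _ that p e subg T(1) s k0]) simp
  \<comment> \<open>The lower tail is the upper tail of the negated noise, which satisfies the same
    moment bound with -t in place of t.\<close>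
  have negsubg: "(\<integral>\<^sup>+q. f (p q) * ennreal (exp (t * - e q)) \<partial>Q)
      \<le> ennreal (exp (t\<^sup>2 * s / 2)) * (\<integral>\<^sup>+q. f (p q) \<partial>Q)" if "f \<in> borel_measurable N" for t f
    using subg[OF that, of "- t"] by simp
  have nege: "(\<lambda>q. - e q) \<in> borel_measurable Q" by measurable
  have L: "measure ?P (L I) \<le> exp (- k) * measure ?X (T I)" if "I \<subseteq> ?J" for I
    unfolding L_def c_def mT[symmetric] \<pi>_def
    by (rule subgaussian_tail_given_trace[OF Q _ that p nege negsubg T(1) s k0]) simp
  have B: "B \<in> sets ?P"
    unfolding B_def by (intro sets.finite_UN sets.Un) (simp_all add: meas)
  have "measure ?P B \<le> (\<Sum>I\<in>Pow ?J. measure ?P (U I \<union> L I))"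
    unfolding B_def by (rule P.finite_measure_subadditive_finite) (auto simp: meas)
  also have "\<dots> \<le> (\<Sum>I\<in>Pow ?J. 2 * exp (- k) * measure ?X (T I))"
  proof (rule sum_mono)
    fix I assume "I \<in> Pow ?J"
    then have I: "I \<subseteq> ?J" by blast
    have "measure ?P (U I \<union> L I) \<le> measure ?P (U I) + measure ?P (L I)"
      by (rule measure_Un_le[OF meas[OF I]])
    with U[OF I] L[OF I] show "measure ?P (U I \<union> L I) \<le> 2 * exp (- k) * measure ?X (T I)"
      by linarith
  qed
  also have "\<dots> = 2 * exp (- k) * (\<Sum>I\<in>Pow ?J. measure ?X (T I))"
    by (rule sum_distrib_left[symmetric])
  also have "\<dots> \<le> 2 * exp (- k) * r"
  proof (rule mult_left_mono)
    show "(\<Sum>I\<in>Pow ?J. measure ?X (T I)) \<le> r"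
      unfolding r_def using T(4) by (simp add: X.emeasure_eq_measure sum_nonneg)
  qed simp
  finally have mB: "measure ?P B \<le> \<delta>" by (simp only: expk)
  show ?thesis
  proof (rule that[OF B mB])
    fix z A assume z: "z \<in> space ?P" "z \<notin> B" and A: "A \<in> \<A>"
    let ?H = "hits n (\<lambda>i. p (z i)) A"
    have "\<pi> z \<in> space ?X" using z(1) by (rule measurable_space[OF \<pi>])
    then have "\<pi> z \<in> T (hits n (\<pi> z) A)" using A by (rule T(2))
    moreover have "hits n (\<pi> z) A = ?H" by (auto simp: hits_def \<pi>_def)
    ultimately have zT: "\<pi> z \<in> T ?H" by simp
    have "?H \<in> Pow ?J" by (auto simp: hits_def)
    with z(2) have "z \<notin> U ?H" "z \<notin> L ?H" unfolding B_def by blast+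
    with z(1) zT have "\<not> c ?H < S ?H z" "\<not> c ?H < - S ?H z"
      unfolding U_def L_def sum_negf S_def[symmetric] by blast+
    then have "\<bar>S ?H z\<bar> \<le> c ?H" by linarith
    then show "\<bar>\<Sum>i\<in>?H. e (z i)\<bar> \<le> sqrt (2 * (s * real (card ?H)) * ln (2 * (real n + 1) ^ v / \<delta>))"
      unfolding S_def c_def k_def .
  qed
qed

section \<open>The sampling model\<close>

text \<open>A function of X can be moved inside the conditional expectation. The resulting
  integrated form depends only on the joint law of X and the noise, so it transfers to the law of
  one observation.\<close>

lemma cond_subgaussian_weight_le:
  assumes M: "prob_space M" and X: "X \<in> measurable M (Rd d)" and \<epsilon>: "\<epsilon> \<in> borel_measurable M"
    and sub: "cond_subgaussian M d X \<epsilon> s" and f: "f \<in> borel_measurable (Rd d)"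
  shows "(\<integral>\<^sup>+\<omega>. f (X \<omega>) * ennreal (exp (t * \<epsilon> \<omega>)) \<partial>M) \<le> ennreal (exp (t\<^sup>2 * s / 2)) * (\<integral>\<^sup>+\<omega>. f (X \<omega>) \<partial>M)"
proof -
  interpret M: prob_space M by fact
  let ?F = "gen_algebra M d X"
  have XF: "X \<in> measurable ?F (Rd d)"
    unfolding gen_algebra_def by (rule measurable_vimage_algebra1) (use X in \<open>auto simp: measurable_def\<close>)
  have "subalgebra M ?F"
    unfolding subalgebra_def gen_algebra_def using X
    by (auto simp: sets_vimage_algebra2 measurable_def)
  then have "finite_measure_subalgebra M ?F"
    by (intro finite_measure_subalgebra.intro finite_measure_subalgebra_axioms.intro M.finite_measure_axioms)
  then interpret sigma_finite_subalgebra M ?F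
    by (rule finite_measure_subalgebra_is_sigma_finite)
  let ?g = "\<lambda>\<omega>. ennreal (exp (t * \<epsilon> \<omega>))"
  have fX: "(\<lambda>\<omega>. f (X \<omega>)) \<in> borel_measurable ?F" using XF f by (rule measurable_compose)
  have fXM: "(\<lambda>\<omega>. f (X \<omega>)) \<in> borel_measurable M" using X f by (rule measurable_compose)
  have "(\<integral>\<^sup>+\<omega>. f (X \<omega>) * ?g \<omega> \<partial>M) = (\<integral>\<^sup>+\<omega>. f (X \<omega>) * nn_cond_exp M ?F ?g \<omega> \<partial>M)"
    by (rule nn_cond_exp_intg[symmetric, OF fX]) (use \<epsilon> in measurable)
  also have "\<dots> \<le> (\<integral>\<^sup>+\<omega>. ennreal (exp (t\<^sup>2 * s / 2)) * f (X \<omega>) \<partial>M)"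
  proof (rule nn_integral_mono_AE)
    have "AE \<omega> in M. nn_cond_exp M ?F ?g \<omega> \<le> ennreal (exp (t\<^sup>2 * s / 2))"
      using sub by (simp add: cond_subgaussian_def)
    then show "AE \<omega> in M. f (X \<omega>) * nn_cond_exp M ?F ?g \<omega> \<le> ennreal (exp (t\<^sup>2 * s / 2)) * f (X \<omega>)"
    proof eventually_elim
      case (elim \<omega>)
      then have "f (X \<omega>) * nn_cond_exp M ?F ?g \<omega> \<le> f (X \<omega>) * ennreal (exp (t\<^sup>2 * s / 2))"
        by (rule mult_left_mono) (rule zero_le)
      then show ?case by (simp only: mult.commute)
    qed
  qed
  also have "\<dots> = ennreal (exp (t\<^sup>2 * s / 2)) * (\<integral>\<^sup>+\<omega>. f (X \<omega>) \<partial>M)"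
    by (rule nn_integral_cmult[OF fXM])
  finally show ?thesis .
qed

text \<open>Reindexing by \<open>Suc\<close> drops the generic pair 0 and renumbers the sample from
  0, which matches the index sets used for traces.\<close>

lemma iid_pairs_sample_law:
  assumes M: "prob_space M" and iid: "iid_pairs M d n X Y" and n: "1 \<le> n"
  shows "(\<lambda>\<omega>. \<lambda>i\<in>{..<n}. (X (Suc i) \<omega>, Y (Suc i) \<omega>)) \<in> measurable M (Pi\<^sub>M {..<n} (\<lambda>_. Rd d \<Otimes>\<^sub>M borel))"
    and "distr M (Pi\<^sub>M {..<n} (\<lambda>_. Rd d \<Otimes>\<^sub>M borel)) (\<lambda>\<omega>. \<lambda>i\<in>{..<n}. (X (Suc i) \<omega>, Y (Suc i) \<omega>))
      = Pi\<^sub>M {..<n} (\<lambda>_. distr M (Rd d \<Otimes>\<^sub>M borel) (\<lambda>\<omega>. (X 0 \<omega>, Y 0 \<omega>)))"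
proof -
  interpret prob_space M by fact
  let ?B = "Rd d \<Otimes>\<^sub>M (borel :: real measure)" and ?Z = "\<lambda>i \<omega>. (X i \<omega>, Y i \<omega>)"
  have ind: "indep_vars (\<lambda>_. ?B) ?Z {0..n}" by (rule conjunct1[OF iid[unfolded iid_pairs_def]])
  then have rv: "?Z i \<in> measurable M ?B" if "i \<le> n" for i
    using that by (simp add: indep_vars_def)
  show "(\<lambda>\<omega>. \<lambda>i\<in>{..<n}. ?Z (Suc i) \<omega>) \<in> measurable M (Pi\<^sub>M {..<n} (\<lambda>_. ?B))"
    by (rule measurable_restrict) (simp add: rv)
  let ?Q = "distr M ?B (?Z 0)"
  have Q: "distr M ?B (?Z i) = ?Q" if "i \<le> n" for i
    by (rule bspec[OF conjunct2[OF iid[unfolded iid_pairs_def]]]) (simp add: that)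
  have psQ: "prob_space ?Q" by (rule prob_space_distr[OF rv]) simp
  have joint: "distr M (Pi\<^sub>M {0..n} (\<lambda>_. ?B)) (\<lambda>\<omega>. \<lambda>i\<in>{0..n}. ?Z i \<omega>) = Pi\<^sub>M {0..n} (\<lambda>_. ?Q)"
  proof -
    have "distr M (Pi\<^sub>M {0..n} (\<lambda>_. ?B)) (\<lambda>\<omega>. \<lambda>i\<in>{0..n}. ?Z i \<omega>) = Pi\<^sub>M {0..n} (\<lambda>i. distr M ?B (?Z i))"
      by (rule indep_vars_iff_distr_eq_PiM'[THEN iffD1, OF _ _ ind]) (simp_all add: rv)
    also have "\<dots> = Pi\<^sub>M {0..n} (\<lambda>_. ?Q)"
      by (rule PiM_cong[OF refl Q]) simp
    finally show ?thesis .
  qed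
  define shift where "shift z = (\<lambda>i\<in>{..<n}. z (Suc i))" for z :: "nat \<Rightarrow> point \<times> real"
  have shift: "shift \<in> measurable (Pi\<^sub>M {0..n} (\<lambda>_. ?B)) (Pi\<^sub>M {..<n} (\<lambda>_. ?B))"
    unfolding shift_def by (intro measurable_restrict measurable_component_singleton) auto
  have Z: "(\<lambda>\<omega>. \<lambda>i\<in>{0..n}. ?Z i \<omega>) \<in> measurable M (Pi\<^sub>M {0..n} (\<lambda>_. ?B))"
    by (rule measurable_restrict) (simp add: rv)
  have "shift \<circ> (\<lambda>\<omega>. \<lambda>i\<in>{0..n}. ?Z i \<omega>) = (\<lambda>\<omega>. \<lambda>i\<in>{..<n}. ?Z (Suc i) \<omega>)"
    by (auto simp: shift_def fun_eq_iff)
  then have "distr M (Pi\<^sub>M {..<n} (\<lambda>_. ?B)) (\<lambda>\<omega>. \<lambda>i\<in>{..<n}. ?Z (Suc i) \<omega>)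
      = distr (distr M (Pi\<^sub>M {0..n} (\<lambda>_. ?B)) (\<lambda>\<omega>. \<lambda>i\<in>{0..n}. ?Z i \<omega>)) (Pi\<^sub>M {..<n} (\<lambda>_. ?B)) shift"
    by (simp only: distr_distr[OF shift Z])
  also have "\<dots> = distr (Pi\<^sub>M {0..n} (\<lambda>_. ?Q)) (Pi\<^sub>M {..<n} (\<lambda>_. ?Q)) shift"
    unfolding joint by (intro distr_cong refl sets_PiM_cong) simp
  also have "\<dots> = Pi\<^sub>M {..<n} (\<lambda>_. ?Q)"
    unfolding shift_def[abs_def] by (rule distr_PiM_reindex[OF psQ]) auto
  finally show "distr M (Pi\<^sub>M {..<n} (\<lambda>_. ?B)) (\<lambda>\<omega>. \<lambda>i\<in>{..<n}. ?Z (Suc i) \<omega>) = Pi\<^sub>M {..<n} (\<lambda>_. ?Q)" .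
qed

section \<open>Lipschitz constants, diameters and the deterministic rates\<close>

lemma lip_const_nonneg:
  assumes "lipschitz d L V g"
  shows "0 \<le> lip_const d g V"
  unfolding lip_const_def using assms by (intro cInf_greatest) (auto simp: lipschitz_def)

lemma lip_const_le:
  assumes "lipschitz d L V g"
  shows "lip_const d g V \<le> L"
  unfolding lip_const_def using assms
  by (intro cInf_lower) (auto simp: lipschitz_def intro!: bdd_belowI[of _ 0])

text \<open>The infimum is itself admissible: at positive distance every admissible constant is at
  least the difference quotient. At distance 0 the given constant L already forces equal values of
  g.\<close>

lemma lip_const_bound:
  assumes "lipschitz d L V g" "x \<in> V" "y \<in> V"
  shows "\<bar>g x - g y\<bar> \<le> lip_const d g V * edist d x y"
proof (cases "edist d x y = 0")
  case True
  moreover have "\<bar>g x - g y\<bar> \<le> L * edist d x y" using assms by (simp add: lipschitz_def)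
  ultimately show ?thesis by simp
next
  case False
  then have pos: "0 < edist d x y" by (simp add: edist_def less_le L2_set_nonneg)
  have "\<bar>g x - g y\<bar> / edist d x y \<le> lip_const d g V"
    unfolding lip_const_def
  proof (rule cInf_greatest)
    show "{K. lipschitz d K V g} \<noteq> {}" using assms(1) by auto
    fix K assume "K \<in> {K. lipschitz d K V g}"
    then have "\<bar>g x - g y\<bar> \<le> K * edist d x y" using assms by (simp add: lipschitz_def)
    then show "\<bar>g x - g y\<bar> / edist d x y \<le> K" using pos by (simp add: divide_le_eq)
  qed
  then show ?thesis using pos by (simp add: divide_le_eq)
qed

text \<open>Taking d-th roots in the shape condition turns the volume exponent d/(d+2) into
  1/(d+2).\<close>

lemma edist_le_of_shape_regular:
  assumes d: "1 \<le> d" and \<gamma>: "0 < \<gamma>" and a: "0 < a" and r: "0 < r"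
    and shape: "diam d V ^ d \<le> ennreal \<gamma> * emeasure (leb d) V"
    and vol: "emeasure (leb d) V \<le> ennreal (a * r powr (real d / (real d + 2)))"
    and x: "x \<in> V" and y: "y \<in> V"
  shows "edist d x y \<le> max 1 a * (\<gamma> powr (1 / real d) * r powr (1 / (real d + 2)))"
proof -
  let ?q = "\<gamma> * (a * r powr (real d / (real d + 2)))"
  have e0: "0 \<le> edist d x y" by (simp add: edist_def L2_set_nonneg)
  have q0: "0 < ?q" using \<gamma> a r by simp
  have "ennreal (edist d x y) \<le> diam d V"
    unfolding diam_def using x y by (intro SUP_upper2[of x] SUP_upper2[of y]) auto
  then have "ennreal (edist d x y) ^ d \<le> diam d V ^ d" by (rule power_mono) simp
  also note shape
  also have "ennreal \<gamma> * emeasure (leb d) V \<le> ennreal \<gamma> * ennreal (a * r powr (real d / (real d + 2)))"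
    by (rule mult_left_mono[OF vol]) simp
  also have "\<dots> = ennreal ?q" by (rule ennreal_mult[symmetric]) (use \<gamma> a in auto)
  finally have "edist d x y ^ d \<le> ?q"
    using e0 q0 by (simp add: ennreal_power)
  then have "(edist d x y ^ d) powr (1 / real d) \<le> ?q powr (1 / real d)"
    using e0 by (intro powr_mono2) auto
  also have "(edist d x y ^ d) powr (1 / real d) = edist d x y"
  proof (cases "edist d x y = 0")
    case False
    with e0 have "0 < edist d x y" by simp
    then show ?thesis using d by (simp add: powr_powr flip: powr_realpow)
  qed (use d in simp)
  also have "?q powr (1 / real d) = a powr (1 / real d) * (\<gamma> powr (1 / real d) * r powr (1 / (real d + 2)))"
    using \<gamma> a r d by (simp add: powr_mult powr_powr field_simps)
  also have "\<dots> \<le> max 1 a * (\<gamma> powr (1 / real d) * r powr (1 / (real d + 2)))"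
  proof (rule mult_right_mono)
    \<comment> \<open>The root of a varies with d; replacing it by \<open>max 1 a\<close> keeps the
      final constant free of the dimension.\<close>
    have "a powr (1 / real d) \<le> max 1 a powr (1 / real d)" using a by (intro powr_mono2) auto
    also have "\<dots> \<le> max 1 a powr 1" using d by (intro powr_mono) auto
    finally show "a powr (1 / real d) \<le> max 1 a" by simp
  qed simp
  finally show ?thesis .
qed

text \<open>In the application m is the sample size, b the minimal mass density at x and r the rate.
  Then 2 s k / N is at most 4 s m r divided by m b a r^(D/(D+2)) / 16, that is 64 s / (a b) times
  r^(2/(D+2)); the root gives the constant 8 and the same power of r as in the bias.\<close>

lemma noise_average_le:
  assumes a: "0 < a" and b: "0 < b" and r: "0 < r" and m: "0 < m" and D: "0 < D" and N: "0 < N"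
    and noise: "\<bar>w\<bar> \<le> sqrt (2 * (s * N) * k)" and s: "0 \<le> s" and k: "0 \<le> k" "k \<le> 2 * (m * r)"
    and mass: "m * (b * (a * r powr (D / (D + 2)))) / 16 \<le> N"
  shows "\<bar>w\<bar> / N \<le> 8 / sqrt a * (sqrt (s / b) * r powr (1 / (D + 2)))"
proof -
  let ?R = "r powr (1 / (D + 2))"
  have R: "r = r powr (D / (D + 2)) * ?R\<^sup>2"
  proof -
    have "?R\<^sup>2 = r powr (2 / (D + 2))"
      by (simp add: power2_eq_square flip: powr_add)
    then have "r powr (D / (D + 2)) * ?R\<^sup>2 = r powr (D / (D + 2) + 2 / (D + 2))"
      by (simp add: powr_add)
    also have "D / (D + 2) + 2 / (D + 2) = 1"
      using D by (simp add: add_divide_distrib[symmetric])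
    finally show ?thesis using r by simp
  qed
  have "sqrt (2 * (s * N) * k) / N = sqrt (2 * (s * N) * k / N\<^sup>2)"
    using N by (simp add: real_sqrt_divide)
  also have "2 * (s * N) * k / N\<^sup>2 = 2 * s * k / N"
    using N by (simp add: power2_eq_square)
  also have "sqrt (2 * s * k / N) \<le> sqrt (64 / a * (s / b) * ?R\<^sup>2)"
  proof (rule real_sqrt_le_mono)
    define q where "q = r powr (D / (D + 2))"
    have rq: "r = q * ?R\<^sup>2" unfolding q_def by (rule R)
    have "2 * s * k \<le> 2 * s * (2 * (m * (q * ?R\<^sup>2)))"
      using k(2) s unfolding rq[symmetric] by (intro mult_left_mono) auto
    also have "\<dots> = 64 / a * (s / b) * ?R\<^sup>2 * (m * (b * (a * q)) / 16)"
      using a b by simp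
    also have "\<dots> \<le> 64 / a * (s / b) * ?R\<^sup>2 * N"
      using mass[folded q_def] a b s by (intro mult_left_mono mult_nonneg_nonneg) auto
    finally show "2 * s * k / N \<le> 64 / a * (s / b) * ?R\<^sup>2"
      by (subst pos_divide_le_eq[OF N])
  qed
  also have "\<dots> = 8 / sqrt a * (sqrt (s / b) * ?R)"
  proof -
    have "sqrt 64 = (8::real)" by (rule real_sqrt_unique) auto
    then show ?thesis by (simp add: real_sqrt_mult real_sqrt_divide)
  qed
  finally have "sqrt (2 * (s * N) * k) / N \<le> 8 / sqrt a * (sqrt (s / b) * ?R)" .
  moreover have "\<bar>w\<bar> / N \<le> sqrt (2 * (s * N) * k) / N"
    by (rule divide_right_mono[OF noise less_imp_le[OF N]])
  ultimately show ?thesis by (rule order_trans[rotated])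
qed

section \<open>Error of the local average\<close>

text \<open>Since \<delta> < 1/3, the argument q of the logarithm is at least 2. Hence the rate is
  positive, and the factor 2 from the two-sided tail costs no more than doubling: ln (2 q) \<le> 2
  ln q.\<close>

lemma rate_bounds:
  assumes n: "1 \<le> n" and \<delta>: "0 < \<delta>" "\<delta> < 1/3"
  shows "0 < rate n v \<delta>"
    and "0 \<le> ln (2 * (real n + 1) ^ v / \<delta>)"
    and "ln (2 * (real n + 1) ^ v / \<delta>) \<le> 2 * (real n * rate n v \<delta>)"
proof -
  define q where "q = (real n + 1) ^ v / \<delta>"
  have "1 \<le> (real n + 1) ^ v" by (rule one_le_power) simp
  with \<delta> have "2 * \<delta> \<le> (real n + 1) ^ v" by linarith
  then have q: "2 \<le> q" using \<delta> by (simp add: q_def le_divide_eq)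
  have nr: "real n * rate n v \<delta> = ln q"
    using n by (simp add: rate_def q_def)
  have "0 < ln q" using q by (intro ln_gt_zero) linarith
  then show "0 < rate n v \<delta>"
    using n unfolding nr[symmetric] by (simp add: zero_less_mult_iff)
  have eq: "ln (2 * (real n + 1) ^ v / \<delta>) = ln 2 + ln q"
    using q by (subst ln_mult_pos[symmetric]) (auto simp: q_def)
  have "ln 2 \<le> ln q" using q by simp
  then show "ln (2 * (real n + 1) ^ v / \<delta>) \<le> 2 * (real n * rate n v \<delta>)"
    unfolding nr eq by linarith
  show "0 \<le> ln (2 * (real n + 1) ^ v / \<delta>)"
    unfolding eq using \<open>0 < ln q\<close> ln_ge_zero[of "2::real"] by linarith
qed

lemma sum_sample_eq_sum_hits:
  fixes f :: "nat \<Rightarrow> real"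
  shows "(\<Sum>i=1..n. f i * indicator A (X i)) = (\<Sum>i\<in>hits n (\<lambda>i. X (Suc i)) A. f (Suc i))"
proof -
  have "(\<Sum>i=1..n. f i * indicator A (X i)) = (\<Sum>i<n. f (Suc i) * indicator A (X (Suc i)))"
    by (simp add: sum.atLeast1_atMost_eq)
  also have "\<dots> = (\<Sum>i<n. if X (Suc i) \<in> A then f (Suc i) else 0)"
    by (rule sum.cong[OF refl]) simp
  also have "\<dots> = (\<Sum>i\<in>hits n (\<lambda>i. X (Suc i)) A. f (Suc i))"
    unfolding hits_def by (rule sum.inter_filter[symmetric]) simp
  finally show ?thesis .
qed

lemma card_sample_eq_card_hits:
  "(\<Sum>i=1..n. indicator A (X i) :: real) = real (card (hits n (\<lambda>i. X (Suc i)) A))"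
  using sum_sample_eq_sum_hits[of "\<lambda>_. 1" A X n] by simp

text \<open>A deterministic statement about one outcome: the two uniform estimates enter as the
  premises \<open>dev\<close> and \<open>noise\<close>.\<close>

lemma pointwise_error_le:
  assumes d: "1 \<le> d" and n: "1 \<le> n" and \<delta>: "0 < \<delta>" "\<delta> < 1/3" and \<gamma>: "0 < \<gamma>" and a: "0 < a1" "0 < a2"
    and PX: "prob_space PX" and ell: "0 < ell" and lip: "lipschitz d L S g"
    and V: "V \<omega> x \<subseteq> S" "x \<in> V \<omega> x"
    and shape: "diam d (V \<omega> x) ^ d \<le> ennreal \<gamma> * emeasure (leb d) (V \<omega> x)"
    and lo: "ennreal (a1 * rate n v \<delta> powr (real d / (real d + 2))) \<le> emeasure (leb d) (V \<omega> x)"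
    and hi: "emeasure (leb d) (V \<omega> x) \<le> ennreal (a2 * rate n v \<delta> powr (real d / (real d + 2)))"
    and mass: "ennreal ell * emeasure (leb d) (V \<omega> x) \<le> emeasure PX (V \<omega> x)"
    and dev: "real n * measure PX (V \<omega> x) / 16 \<le> real (card (hits n (\<lambda>i. X (Suc i) \<omega>) (V \<omega> x)))"
    and noise: "\<bar>\<Sum>i\<in>hits n (\<lambda>i. X (Suc i) \<omega>) (V \<omega> x). Y (Suc i) \<omega> - g (X (Suc i) \<omega>)\<bar>
      \<le> sqrt (2 * (\<sigma>\<^sup>2 * real (card (hits n (\<lambda>i. X (Suc i) \<omega>) (V \<omega> x)))) * ln (2 * (real n + 1) ^ v / \<delta>))"
  shows "\<bar>ghat n X Y V \<omega> x - g x\<bar> \<le>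
      8 / sqrt a1 * (sqrt (\<sigma>\<^sup>2 / ell) * rate n v \<delta> powr (1 / (real d + 2)))
    + lip_const d g (V \<omega> x) * (max 1 a2 * (\<gamma> powr (1 / real d) * rate n v \<delta> powr (1 / (real d + 2))))"
proof -
  interpret PX: prob_space PX by fact
  define r where "r = rate n v \<delta>"
  define H where "H = hits n (\<lambda>i. X (Suc i) \<omega>) (V \<omega> x)"
  define N where "N = real (card H)"
  define c where "c = max 1 a2 * (\<gamma> powr (1 / real d) * r powr (1 / (real d + 2)))"
  have r: "0 < r" unfolding r_def by (rule rate_bounds(1)[OF n \<delta>])
  have lipV: "lipschitz d L (V \<omega> x) g"
    unfolding lipschitz_def using lip V(1) by (meson lipschitz_def subsetD)
  have "ennreal (ell * (a1 * r powr (real d / (real d + 2))))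
      = ennreal ell * ennreal (a1 * r powr (real d / (real d + 2)))"
    by (rule ennreal_mult) (use ell a in auto)
  also have "\<dots> \<le> ennreal ell * emeasure (leb d) (V \<omega> x)"
    unfolding r_def by (rule mult_left_mono[OF lo]) (rule zero_le)
  also note mass
  finally have "ell * (a1 * r powr (real d / (real d + 2))) \<le> measure PX (V \<omega> x)"
    unfolding PX.emeasure_eq_measure by (subst (asm) ennreal_le_iff) auto
  then have "real n * (ell * (a1 * r powr (real d / (real d + 2)))) / 16 \<le> real n * measure PX (V \<omega> x) / 16"
    by (intro divide_right_mono mult_left_mono) auto
  also note dev
  finally have massN: "real n * (ell * (a1 * r powr (real d / (real d + 2)))) / 16 \<le> N"
    unfolding N_def H_def .
  \<comment> \<open>The local set contains a sample point, so the value 0/0 = 0 in the estimator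
    never occurs.\<close>
  have "0 < real n * (ell * (a1 * r powr (real d / (real d + 2)))) / 16"
    using n ell a r by simp
  with massN have N: "0 < N" by linarith
  define W where "W = (\<Sum>i\<in>H. Y (Suc i) \<omega> - g (X (Suc i) \<omega>))"
  define G where "G = (\<Sum>i\<in>H. g (X (Suc i) \<omega>) - g x)"
  have "ghat n X Y V \<omega> x = (\<Sum>i\<in>H. Y (Suc i) \<omega>) / N"
    unfolding ghat_def N_def H_def
    by (simp only: sum_sample_eq_sum_hits[of "\<lambda>i. Y i \<omega>" _ "\<lambda>i. X i \<omega>"]
        card_sample_eq_card_hits[of _ "\<lambda>i. X i \<omega>"])
  \<comment> \<open>Each response is its noise, plus the increment of g from x, plus g x.\<close>
  also have "(\<Sum>i\<in>H. Y (Suc i) \<omega>) = W + G + N * g x"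
    unfolding W_def G_def N_def by (simp add: sum_subtractf)
  also have "(W + G + N * g x) / N = W / N + G / N + g x"
    using N by (simp add: add_divide_distrib)
  finally have "ghat n X Y V \<omega> x - g x = W / N + G / N" by simp
  then have "\<bar>ghat n X Y V \<omega> x - g x\<bar> \<le> \<bar>W / N\<bar> + \<bar>G / N\<bar>" by linarith
  also have "\<bar>W / N\<bar> = \<bar>W\<bar> / N" using N by (simp add: abs_divide)
  also have "\<bar>W\<bar> / N \<le> 8 / sqrt a1 * (sqrt (\<sigma>\<^sup>2 / ell) * r powr (1 / (real d + 2)))"
  proof (rule noise_average_le[OF a(1) ell r _ _ N _ _ _ _ massN])
    show "\<bar>W\<bar> \<le> sqrt (2 * (\<sigma>\<^sup>2 * N) * ln (2 * (real n + 1) ^ v / \<delta>))"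
      using noise unfolding W_def N_def H_def .
    show "0 \<le> ln (2 * (real n + 1) ^ v / \<delta>)" "ln (2 * (real n + 1) ^ v / \<delta>) \<le> 2 * (real n * r)"
      unfolding r_def by (rule rate_bounds[OF n \<delta>])+
  qed (use n d in auto)
  also have "\<bar>G / N\<bar> = \<bar>G\<bar> / N" using N by (simp add: abs_divide)
  also have "\<bar>G\<bar> / N \<le> lip_const d g (V \<omega> x) * c"
  proof -
    have "\<bar>G\<bar> \<le> (\<Sum>i\<in>H. \<bar>g (X (Suc i) \<omega>) - g x\<bar>)" unfolding G_def by (rule sum_abs)
    also have "\<dots> \<le> (\<Sum>i\<in>H. lip_const d g (V \<omega> x) * c)"
    proof (rule sum_mono)
      fix i assume "i \<in> H"
      then have Xi: "X (Suc i) \<omega> \<in> V \<omega> x" by (simp add: H_def hits_def)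
      have "\<bar>g (X (Suc i) \<omega>) - g x\<bar> \<le> lip_const d g (V \<omega> x) * edist d (X (Suc i) \<omega>) x"
        by (rule lip_const_bound[OF lipV Xi V(2)])
      also have "\<dots> \<le> lip_const d g (V \<omega> x) * c"
        unfolding c_def r_def
        by (rule mult_left_mono[OF edist_le_of_shape_regular[OF d \<gamma> a(2) r[unfolded r_def] shape hi Xi V(2)]
              lip_const_nonneg[OF lipV]])
      finally show "\<bar>g (X (Suc i) \<omega>) - g x\<bar> \<le> lip_const d g (V \<omega> x) * c" .
    qed
    also have "\<dots> = lip_const d g (V \<omega> x) * c * N" by (simp add: N_def)
    finally show ?thesis by (subst pos_divide_le_eq[OF N])
  qed
  finally show ?thesis unfolding c_def r_def by simp
qed

text \<open>Q need not be measurable. The witness event is the complement of two pulled-back bad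
  events and a null set outside which C holds.\<close>

lemma with_prob_at_least_sampleI:
  assumes M: "prob_space M" and Z: "Z \<in> measurable M R" and law: "distr M R Z = P"
    and B: "B1 \<in> sets P" "measure P B1 \<le> \<delta>" "B2 \<in> sets P" "measure P B2 \<le> \<delta>" and \<delta>: "0 \<le> \<delta>"
    and ae: "AE \<omega> in M. C \<omega>"
    and Q: "\<And>\<omega>. \<omega> \<in> space M \<Longrightarrow> C \<omega> \<Longrightarrow> Z \<omega> \<notin> B1 \<Longrightarrow> Z \<omega> \<notin> B2 \<Longrightarrow> Q \<omega>"
  shows "with_prob_at_least M (1 - 3 * \<delta>) Q"
proof -
  interpret prob_space M by fact
  obtain N where N: "{\<omega> \<in> space M. \<not> C \<omega>} \<subseteq> N" "emeasure M N = 0" "N \<in> sets M"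
    using ae by (rule AE_E)
  let ?D = "\<lambda>B. Z -` B \<inter> space M"
  have D: "?D B \<in> sets M" "measure M (?D B) = measure P B" if "B \<in> sets P" for B
  proof -
    from that have "B \<in> sets R" unfolding law[symmetric] by simp
    then show "?D B \<in> sets M" using Z by (rule measurable_sets[rotated])
    show "measure M (?D B) = measure P B"
      unfolding law[symmetric] by (rule measure_distr[OF Z \<open>B \<in> sets R\<close>, symmetric])
  qed
  let ?F = "?D B1 \<union> ?D B2 \<union> N"
  have F: "?F \<in> sets M" using D(1)[OF B(1)] D(1)[OF B(3)] N(3) by (intro sets.Un)
  have "measure M ?F \<le> measure M (?D B1 \<union> ?D B2) + measure M N"
    using D(1)[OF B(1)] D(1)[OF B(3)] N(3) by (intro measure_Un_le sets.Un)
  also have "measure M (?D B1 \<union> ?D B2) \<le> measure M (?D B1) + measure M (?D B2)"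
    by (rule measure_Un_le[OF D(1)[OF B(1)] D(1)[OF B(3)]])
  also have "measure M N = 0" using N(2) by (simp add: measure_def)
  finally have "measure M ?F \<le> 3 * \<delta>"
    using B(2,4) \<delta> unfolding D(2)[OF B(1)] D(2)[OF B(3)] by linarith
  then have "1 - 3 * \<delta> \<le> measure M (space M - ?F)" unfolding prob_compl[OF F] by linarith
  moreover have "space M - ?F \<in> sets M" using F by (rule sets.compl_sets)
  moreover have "Q \<omega>" if \<omega>: "\<omega> \<in> space M - ?F" for \<omega>
    by (rule Q) (use \<omega> N(1) in blast)+
  ultimately show ?thesis unfolding with_prob_at_least_def by blast
qed

lemma with_prob_at_least_mono:
  assumes "with_prob_at_least M p Q" "\<And>\<omega>. \<omega> \<in> space M \<Longrightarrow> Q \<omega> \<Longrightarrow> Q' \<omega>"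
  shows "with_prob_at_least M p Q'"
  using assms sets.sets_into_space unfolding with_prob_at_least_def by blast

text \<open>Both bad events are built from the class and the law alone, before the map is consulted;
  arbitrary dependence of V on the sample is therefore allowed.\<close>

lemma local_regression_bound:
  assumes d: "1 \<le> d" and n: "1 \<le> n" and \<delta>: "0 < \<delta>" "\<delta> < 1/3" and \<gamma>: "0 < \<gamma>" and a: "0 < a1" "0 < a2"
    and M: "prob_space M" and iid: "iid_pairs M d n X Y"
    and g: "g \<in> borel_measurable (Rd d)"
    and sub: "cond_subgaussian M d (X 0) (\<lambda>\<omega>. Y 0 \<omega> - g (X 0 \<omega>)) (\<sigma>\<^sup>2)"
    and lip: "lipschitz d L S g"
    and lm: "\<forall>\<omega>\<in>space M. local_map d S (V \<omega>)"
    and mm: "minimal_mass M d (law M d (X 0)) S V ell"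
    and vc: "vc_map M d (law M d (X 0)) S V v"
    and lg: "large_map M n X (law M d (X 0)) S V v \<delta>"
    and sr: "\<forall>\<omega>\<in>space M. shape_regular d S \<gamma> (V \<omega>)"
    and vol: "\<forall>\<omega>\<in>space M. \<forall>x\<in>S.
         ennreal (a1 * rate n v \<delta> powr (real d / (real d + 2))) \<le> emeasure (leb d) (V \<omega> x) \<and>
         emeasure (leb d) (V \<omega> x) \<le> ennreal (a2 * rate n v \<delta> powr (real d / (real d + 2)))"
  shows "with_prob_at_least M (1 - 3 * \<delta>) (\<lambda>\<omega>. \<forall>x\<in>S. \<bar>ghat n X Y V \<omega> x - g x\<bar> \<le>
      8 / sqrt a1 * (sqrt (\<sigma>\<^sup>2 / ell x) * rate n v \<delta> powr (1 / (real d + 2)))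
    + lip_const d g (V \<omega> x) * (max 1 a2 * (\<gamma> powr (1 / real d) * rate n v \<delta> powr (1 / (real d + 2)))))"
proof -
  interpret prob_space M by fact
  let ?R = "Rd d \<Otimes>\<^sub>M (borel :: real measure)"
  define Q where "Q = distr M ?R (\<lambda>\<omega>. (X 0 \<omega>, Y 0 \<omega>))"
  define PX where "PX = law M d (X 0)"
  define Z where "Z \<omega> = (\<lambda>i\<in>{..<n}. (X (Suc i) \<omega>, Y (Suc i) \<omega>))" for \<omega>
  define e where "e q = snd q - g (fst q)" for q :: "point \<times> real"
  define \<pi> where "\<pi> z = (\<lambda>i\<in>{..<n}. fst (z i))" for z :: "nat \<Rightarrow> point \<times> real"
  have XY [measurable]: "(\<lambda>\<omega>. (X 0 \<omega>, Y 0 \<omega>)) \<in> measurable M ?R"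
    using conjunct1[OF iid[unfolded iid_pairs_def]] by (simp add: indep_vars_def)
  have X0 [measurable]: "X 0 \<in> measurable M (Rd d)"
    using measurable_compose[OF XY measurable_fst] by simp
  have Y0 [measurable]: "Y 0 \<in> borel_measurable M"
    using measurable_compose[OF XY measurable_snd] by simp
  have psQ: "prob_space Q" unfolding Q_def by (rule prob_space_distr[OF XY])
  have psPX: "prob_space PX" unfolding PX_def law_def by (rule prob_space_distr[OF X0])
  have setsQ: "sets Q = sets ?R" by (simp add: Q_def)
  have setsPX: "sets PX = sets (Rd d)" by (simp add: PX_def law_def)
  have p: "fst \<in> measurable Q PX"
    using measurable_fst unfolding measurable_cong_sets[OF setsQ setsPX] .
  have e: "e \<in> borel_measurable Q"
    unfolding measurable_cong_sets[OF setsQ refl] e_def[abs_def] using g by measurable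
  have "distr Q PX fst = distr Q (Rd d) fst" by (rule distr_cong[OF refl setsPX refl])
  also have "\<dots> = distr M (Rd d) (fst \<circ> (\<lambda>\<omega>. (X 0 \<omega>, Y 0 \<omega>)))"
    unfolding Q_def by (rule distr_distr[OF measurable_fst XY])
  also have "\<dots> = PX" by (simp add: PX_def law_def comp_def)
  finally have QPX: "distr Q PX fst = PX" .
  have subg: "(\<integral>\<^sup>+q. f (fst q) * ennreal (exp (t * e q)) \<partial>Q)
      \<le> ennreal (exp (t\<^sup>2 * \<sigma>\<^sup>2 / 2)) * (\<integral>\<^sup>+q. f (fst q) \<partial>Q)" if "f \<in> borel_measurable PX" for t f
  proof -
    have f: "f \<in> borel_measurable (Rd d)" using that unfolding measurable_cong_sets[OF setsPX refl] .
    have fm: "(\<lambda>q. f (fst q)) \<in> borel_measurable ?R" using measurable_fst f by (rule measurable_compose)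
    have em: "e \<in> borel_measurable ?R" using e unfolding measurable_cong_sets[OF setsQ refl] .
    have fe: "(\<lambda>q. f (fst q) * ennreal (exp (t * e q))) \<in> borel_measurable ?R"
      using fm em by measurable
    have "(\<integral>\<^sup>+q. f (fst q) * ennreal (exp (t * e q)) \<partial>Q)
        = (\<integral>\<^sup>+\<omega>. f (fst (X 0 \<omega>, Y 0 \<omega>)) * ennreal (exp (t * e (X 0 \<omega>, Y 0 \<omega>))) \<partial>M)"
      unfolding Q_def by (rule nn_integral_distr[OF XY]) (simp add: fe)
    also have "\<dots> = (\<integral>\<^sup>+\<omega>. f (X 0 \<omega>) * ennreal (exp (t * (Y 0 \<omega> - g (X 0 \<omega>)))) \<partial>M)"
      by (simp add: e_def)
    also have "\<dots> \<le> ennreal (exp (t\<^sup>2 * \<sigma>\<^sup>2 / 2)) * (\<integral>\<^sup>+\<omega>. f (X 0 \<omega>) \<partial>M)"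
      by (rule cond_subgaussian_weight_le[OF M X0 _ sub f]) (use g in measurable)
    also have "(\<integral>\<^sup>+\<omega>. f (X 0 \<omega>) \<partial>M) = (\<integral>\<^sup>+q. f (fst q) \<partial>Q)"
      unfolding Q_def using fm by (subst nn_integral_distr[OF XY]) simp_all
    finally show ?thesis .
  qed
  obtain \<A> where \<A>: "has_vc_dim \<A> v" "trace_measurable PX \<A>" "\<And>\<omega> x. \<omega> \<in> space M \<Longrightarrow> x \<in> S \<Longrightarrow> V \<omega> x \<in> \<A>"
    using vc unfolding vc_map_def PX_def by blast
  have \<delta>1: "\<delta> < 1" using \<delta> by simp
  obtain B1 where B1: "B1 \<in> sets (Pi\<^sub>M {..<n} (\<lambda>_. PX))" "measure (Pi\<^sub>M {..<n} (\<lambda>_. PX)) B1 \<le> \<delta>"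
    "\<And>x A. x \<in> space (Pi\<^sub>M {..<n} (\<lambda>_. PX)) \<Longrightarrow> x \<notin> B1 \<Longrightarrow> A \<in> \<A> \<Longrightarrow> A \<in> sets PX \<Longrightarrow>
      8 * ln (4 * (2 * real n + 1) ^ v / \<delta>) \<le> real n * measure PX A \<Longrightarrow>
      real n * measure PX A / 16 \<le> real (card (hits n x A))"
    using relative_deviation[OF psPX \<A>(2,1) n \<delta>(1) \<delta>1] by blast
  obtain B2 where B2: "B2 \<in> sets (Pi\<^sub>M {..<n} (\<lambda>_. Q))" "measure (Pi\<^sub>M {..<n} (\<lambda>_. Q)) B2 \<le> \<delta>"
    "\<And>z A. z \<in> space (Pi\<^sub>M {..<n} (\<lambda>_. Q)) \<Longrightarrow> z \<notin> B2 \<Longrightarrow> A \<in> \<A> \<Longrightarrow>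
      \<bar>\<Sum>i\<in>hits n (\<lambda>i. fst (z i)) A. e (z i)\<bar>
        \<le> sqrt (2 * (\<sigma>\<^sup>2 * real (card (hits n (\<lambda>i. fst (z i)) A))) * ln (2 * (real n + 1) ^ v / \<delta>))"
    using uniform_noise_bound[OF psQ p QPX e subg _ \<A>(2,1) \<delta>(1) \<delta>1, where n = n] zero_le_power2 by blast
  have \<pi>m: "\<pi> \<in> measurable (Pi\<^sub>M {..<n} (\<lambda>_. Q)) (Pi\<^sub>M {..<n} (\<lambda>_. PX))"
    unfolding \<pi>_def[abs_def]
  proof (rule measurable_restrict)
    fix i assume "i \<in> {..<n}"
    from measurable_compose[OF measurable_component_singleton[OF this] p]
    show "(\<lambda>z. fst (z i)) \<in> measurable (Pi\<^sub>M {..<n} (\<lambda>_. Q)) PX" .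
  qed
  \<comment> \<open>The deviation event concerns the design only; it is lifted to the product of the
    pair laws, where the noise event lives.\<close>
  define B1' where "B1' = \<pi> -` B1 \<inter> space (Pi\<^sub>M {..<n} (\<lambda>_. Q))"
  have B1': "B1' \<in> sets (Pi\<^sub>M {..<n} (\<lambda>_. Q))"
    unfolding B1'_def by (rule measurable_sets[OF \<pi>m B1(1)])
  have "measure (Pi\<^sub>M {..<n} (\<lambda>_. Q)) B1' = measure (distr (Pi\<^sub>M {..<n} (\<lambda>_. Q)) (Pi\<^sub>M {..<n} (\<lambda>_. PX)) \<pi>) B1"
    unfolding B1'_def by (rule measure_distr[OF \<pi>m B1(1), symmetric])
  also have "\<dots> = measure (Pi\<^sub>M {..<n} (\<lambda>_. PX)) B1"
    unfolding \<pi>_def[abs_def] distr_PiM_pointwise[OF psQ p QPX finite_lessThan] ..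
  finally have mB1': "measure (Pi\<^sub>M {..<n} (\<lambda>_. Q)) B1' \<le> \<delta>" using B1(2) by simp
  note sample = iid_pairs_sample_law[OF M iid n, folded Q_def, folded Z_def[abs_def]]
  have spaceQ: "space (Pi\<^sub>M {..<n} (\<lambda>_. Q)) = space (Pi\<^sub>M {..<n} (\<lambda>_. ?R))"
    unfolding sample(2)[symmetric] by simp
  define C where "C \<omega> \<longleftrightarrow> (\<forall>x\<in>S. ennreal (ell x) * emeasure (leb d) (V \<omega> x) \<le> emeasure PX (V \<omega> x)) \<and>
      (\<forall>x\<in>S. 8 * ln (4 * (2 * real n + 1) ^ v / \<delta>) \<le> real n * max (emp n X \<omega> (V \<omega> x)) (measure PX (V \<omega> x)))" for \<omega>
  have ae: "AE \<omega> in M. C \<omega>"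
    using mm lg unfolding C_def PX_def minimal_mass_def large_map_def by (intro AE_conjI) blast+
  show ?thesis
  proof (rule with_prob_at_least_sampleI[OF M sample B1' mB1' B2(1,2) less_imp_le[OF \<delta>(1)] ae], intro ballI)
    fix \<omega> x assume \<omega>: "\<omega> \<in> space M" and C: "C \<omega>" and ZB: "Z \<omega> \<notin> B1'" "Z \<omega> \<notin> B2" and x: "x \<in> S"
    let ?A = "V \<omega> x" and ?H = "hits n (\<lambda>i. X (Suc i) \<omega>) (V \<omega> x)"
    have Zs: "Z \<omega> \<in> space (Pi\<^sub>M {..<n} (\<lambda>_. Q))"
      unfolding spaceQ using sample(1) \<omega> by (rule measurable_space)
    have \<pi>s: "\<pi> (Z \<omega>) \<in> space (Pi\<^sub>M {..<n} (\<lambda>_. PX))" using \<pi>m Zs by (rule measurable_space)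
    have \<pi>B: "\<pi> (Z \<omega>) \<notin> B1" using ZB(1) Zs unfolding B1'_def by blast
    have A: "?A \<in> \<A>" using \<omega> x by (rule \<A>(3))
    have lmx: "?A \<in> sets (Rd d)" "?A \<subseteq> S" "x \<in> ?A"
      using lm \<omega> x unfolding local_map_def by blast+
    have AP: "?A \<in> sets PX" unfolding setsPX by (rule lmx(1))
    have H1: "hits n (\<pi> (Z \<omega>)) ?A = ?H" by (auto simp: hits_def \<pi>_def Z_def)
    have H2: "hits n (\<lambda>i. fst (Z \<omega> i)) ?A = ?H" by (auto simp: hits_def Z_def)
    have emp: "real n * emp n X \<omega> ?A = real (card ?H)"
      unfolding emp_def card_sample_eq_card_hits[of _ "\<lambda>i. X i \<omega>"] using n by simp
    show "\<bar>ghat n X Y V \<omega> x - g x\<bar> \<le>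
      8 / sqrt a1 * (sqrt (\<sigma>\<^sup>2 / ell x) * rate n v \<delta> powr (1 / (real d + 2)))
      + lip_const d g ?A * (max 1 a2 * (\<gamma> powr (1 / real d) * rate n v \<delta> powr (1 / (real d + 2))))"
    proof (rule pointwise_error_le[where V = V and \<omega> = \<omega> and x = x, OF d n \<delta> \<gamma> a psPX _ lip lmx(2,3)])
      show "0 < ell x" using mm x unfolding minimal_mass_def by blast
      show "diam d ?A ^ d \<le> ennreal \<gamma> * emeasure (leb d) ?A"
        using sr \<omega> x unfolding shape_regular_def by blast
      show "ennreal (a1 * rate n v \<delta> powr (real d / (real d + 2))) \<le> emeasure (leb d) ?A"
        "emeasure (leb d) ?A \<le> ennreal (a2 * rate n v \<delta> powr (real d / (real d + 2)))"
        using vol \<omega> x by blast+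
      show "ennreal (ell x) * emeasure (leb d) ?A \<le> emeasure PX ?A"
        using C x unfolding C_def by blast
      show "real n * measure PX ?A / 16 \<le> real (card ?H)"
      proof (cases "8 * ln (4 * (2 * real n + 1) ^ v / \<delta>) \<le> real n * measure PX ?A")
        case True
        from B1(3)[OF \<pi>s \<pi>B A AP this] show ?thesis unfolding H1 .
      next
        case False
        \<comment> \<open>Below the threshold the maximum must be the empirical mass, so the sample
          count already exceeds n times the mass of the set.\<close>
        have "8 * ln (4 * (2 * real n + 1) ^ v / \<delta>) \<le> real n * max (emp n X \<omega> ?A) (measure PX ?A)"
          using C x unfolding C_def by blast
        with False have "real n * measure PX ?A < real (card ?H)"
          unfolding emp[symmetric] by (auto simp: max_def split: if_splits)
        moreover have "0 \<le> real n * measure PX ?A" by simp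
        ultimately show ?thesis by linarith
      qed
      have "(\<Sum>i\<in>?H. e (Z \<omega> i)) = (\<Sum>i\<in>?H. Y (Suc i) \<omega> - g (X (Suc i) \<omega>))"
        by (rule sum.cong[OF refl]) (simp add: hits_def Z_def e_def)
      then show "\<bar>\<Sum>i\<in>?H. Y (Suc i) \<omega> - g (X (Suc i) \<omega>)\<bar>
          \<le> sqrt (2 * (\<sigma>\<^sup>2 * real (card ?H)) * ln (2 * (real n + 1) ^ v / \<delta>))"
        using B2(3)[OF Zs ZB(2) A] unfolding H2 by simp
    qed
  qed
qed

text \<open>Both constants are enlarged to their sum, which adds only nonnegative cross
  terms.\<close>

lemma combine_error_terms:
  fixes c m s s' l l' G R :: real
  assumes "0 \<le> c" "0 \<le> m" "0 \<le> s" "s \<le> s'" "0 \<le> l" "l \<le> l'" "0 \<le> G" "0 \<le> R"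
  shows "c * (s * R) + l * (m * (G * R)) \<le> (c + m) * (s' + l' * G) * R"
proof -
  have "l * G \<le> l' * G" using assms by (intro mult_right_mono)
  then have "c * s + m * (l * G) \<le> (c + m) * s' + (c + m) * (l' * G)"
    using assms by (intro add_mono mult_mono) auto
  then have "(c * s + m * (l * G)) * R \<le> ((c + m) * s' + (c + m) * (l' * G)) * R"
    using assms by (intro mult_right_mono)
  then show ?thesis by (simp add: algebra_simps)
qed

theorem theorem12:
  fixes a1 a2 :: real
  assumes "0 < a1" and "a1 \<le> a2"
  shows "\<exists>A>0. \<forall>(d::nat) (n::nat) (v::nat) (\<delta>::real) (\<gamma>::real) (\<sigma>::real) (L::real)
      (M :: 'w measure) (X :: nat \<Rightarrow> 'w \<Rightarrow> point) (Y :: nat \<Rightarrow> 'w \<Rightarrow> real)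
      (S :: point set) (g :: point \<Rightarrow> real) (V :: 'w \<Rightarrow> point \<Rightarrow> point set) (ell :: point \<Rightarrow> real).
      1 \<le> d \<longrightarrow> 1 \<le> n \<longrightarrow> 0 < \<delta> \<longrightarrow> \<delta> < 1/3 \<longrightarrow> 0 < \<gamma> \<longrightarrow>
      prob_space M \<longrightarrow>
      iid_pairs M d n X Y \<longrightarrow>
      S \<subseteq> space (Rd d) \<longrightarrow>
      (AE \<omega> in M. X 0 \<omega> \<in> S) \<longrightarrow>
      regression_fun M d (X 0) (Y 0) g \<longrightarrow>
      cond_subgaussian M d (X 0) (\<lambda>\<omega>. Y 0 \<omega> - g (X 0 \<omega>)) (\<sigma>\<^sup>2) \<longrightarrow>
      lipschitz d L S g \<longrightarrow>
      (\<forall>\<omega>\<in>space M. local_map d S (V \<omega>)) \<longrightarrow>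
      minimal_mass M d (law M d (X 0)) S V ell \<longrightarrow>
      vc_map M d (law M d (X 0)) S V v \<longrightarrow>
      large_map M n X (law M d (X 0)) S V v \<delta> \<longrightarrow>
      (\<forall>\<omega>\<in>space M. shape_regular d S \<gamma> (V \<omega>)) \<longrightarrow>
      (\<forall>\<omega>\<in>space M. \<forall>x\<in>S.
         ennreal (a1 * rate n v \<delta> powr (real d / (real d + 2))) \<le> emeasure (leb d) (V \<omega> x) \<and>
         emeasure (leb d) (V \<omega> x) \<le> ennreal (a2 * rate n v \<delta> powr (real d / (real d + 2)))) \<longrightarrow>
      with_prob_at_least M (1 - 3 * \<delta>) (\<lambda>\<omega>. \<forall>x\<in>S.
         \<bar>ghat n X Y V \<omega> x - g x\<bar>
           \<le> A * (sqrt (3 * \<sigma>\<^sup>2 / ell x) + lip_const d g (V \<omega> x) * \<gamma> powr (1 / real d))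
               * rate n v \<delta> powr (1 / (real d + 2))) \<and>
      (\<forall>b>0. ebounded d S \<longrightarrow> (\<forall>x\<in>S. b \<le> ell x) \<longrightarrow>
        with_prob_at_least M (1 - 3 * \<delta>) (\<lambda>\<omega>.
         (SUP x\<in>S. ereal \<bar>ghat n X Y V \<omega> x - g x\<bar>)
           \<le> ereal (A * (sqrt (3 * \<sigma>\<^sup>2 / b) + L * \<gamma> powr (1 / real d))
               * rate n v \<delta> powr (1 / (real d + 2)))))"
proof -
  \<comment> \<open>The noise constant c depends on a1 only and the bias constant m on a2 only; the
    witness is A = c + m.\<close>
  define c where "c = 8 / sqrt a1"
  define m where "m = max 1 a2"
  have cm: "0 < c" "0 < m" using assms by (auto simp: c_def m_def)
  have a2: "0 < a2" using assms by linarith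
  show ?thesis
  proof (intro exI[of _ "c + m"] conjI allI impI)
    show "0 < c + m" using cm by simp
  next
    fix d n v :: nat and \<delta> \<gamma> \<sigma> L :: real and M :: "'w measure"
      and X :: "nat \<Rightarrow> 'w \<Rightarrow> point" and Y :: "nat \<Rightarrow> 'w \<Rightarrow> real"
      and S :: "point set" and g :: "point \<Rightarrow> real" and V :: "'w \<Rightarrow> point \<Rightarrow> point set"
      and ell :: "point \<Rightarrow> real"
    assume asm: "1 \<le> d" "1 \<le> n" "0 < \<delta>" "\<delta> < 1/3" "0 < \<gamma>" "prob_space M" "iid_pairs M d n X Y"
      and reg: "regression_fun M d (X 0) (Y 0) g"
      and sub: "cond_subgaussian M d (X 0) (\<lambda>\<omega>. Y 0 \<omega> - g (X 0 \<omega>)) (\<sigma>\<^sup>2)"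
      and lip: "lipschitz d L S g" and lm: "\<forall>\<omega>\<in>space M. local_map d S (V \<omega>)"
      and mm: "minimal_mass M d (law M d (X 0)) S V ell"
      and rest: "vc_map M d (law M d (X 0)) S V v"
        "large_map M n X (law M d (X 0)) S V v \<delta>"
        "\<forall>\<omega>\<in>space M. shape_regular d S \<gamma> (V \<omega>)"
        "\<forall>\<omega>\<in>space M. \<forall>x\<in>S.
         ennreal (a1 * rate n v \<delta> powr (real d / (real d + 2))) \<le> emeasure (leb d) (V \<omega> x) \<and>
         emeasure (leb d) (V \<omega> x) \<le> ennreal (a2 * rate n v \<delta> powr (real d / (real d + 2)))"
    let ?G = "\<gamma> powr (1 / real d)" and ?R = "rate n v \<delta> powr (1 / (real d + 2))"
    let ?err = "\<lambda>\<omega> x. \<bar>ghat n X Y V \<omega> x - g x\<bar>"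
    have g: "g \<in> borel_measurable (Rd d)" using reg by (simp add: regression_fun_def)
    have bound: "with_prob_at_least M (1 - 3 * \<delta>) (\<lambda>\<omega>. \<forall>x\<in>S. ?err \<omega> x \<le>
        c * (sqrt (\<sigma>\<^sup>2 / ell x) * ?R) + lip_const d g (V \<omega> x) * (m * (?G * ?R)))"
      unfolding c_def m_def
      by (rule local_regression_bound[OF asm(1-5) assms(1) a2 asm(6,7) g sub lip lm mm rest])
    have ell: "0 < ell x" if "x \<in> S" for x
      using mm that unfolding minimal_mass_def by blast
    have lipV: "lipschitz d L (V \<omega> x) g" if "\<omega> \<in> space M" "x \<in> S" for \<omega> x
    proof -
      have "V \<omega> x \<subseteq> S" using lm that unfolding local_map_def by blast
      then show ?thesis using lip unfolding lipschitz_def by blast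
    qed
    \<comment> \<open>Stated for general b and l so as to serve both claims: b =
      \<open>ell x\<close> with the local Lipschitz constant, and the uniform lower bound b with
      L.\<close>
    have combine: "?err \<omega> x \<le> (c + m) * (sqrt (3 * \<sigma>\<^sup>2 / b) + l * ?G) * ?R"
      if "\<omega> \<in> space M" "x \<in> S" "0 < b" "b \<le> ell x" "lip_const d g (V \<omega> x) \<le> l"
        and le: "?err \<omega> x \<le> c * (sqrt (\<sigma>\<^sup>2 / ell x) * ?R) + lip_const d g (V \<omega> x) * (m * (?G * ?R))"
      for \<omega> x b l
    proof -
      have "\<sigma>\<^sup>2 / ell x \<le> 3 * \<sigma>\<^sup>2 / b" using that(3,4) by (intro frac_le) auto
      then have "sqrt (\<sigma>\<^sup>2 / ell x) \<le> sqrt (3 * \<sigma>\<^sup>2 / b)" by (rule real_sqrt_le_mono)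
      moreover have "0 \<le> sqrt (\<sigma>\<^sup>2 / ell x)" using ell[OF that(2)] by simp
      ultimately have "c * (sqrt (\<sigma>\<^sup>2 / ell x) * ?R) + lip_const d g (V \<omega> x) * (m * (?G * ?R))
          \<le> (c + m) * (sqrt (3 * \<sigma>\<^sup>2 / b) + l * ?G) * ?R"
        using cm that(5) lip_const_nonneg[OF lipV[OF that(1,2)]] by (intro combine_error_terms) auto
      with le show ?thesis by (rule order_trans)
    qed
    show "with_prob_at_least M (1 - 3 * \<delta>) (\<lambda>\<omega>. \<forall>x\<in>S. ?err \<omega> x
        \<le> (c + m) * (sqrt (3 * \<sigma>\<^sup>2 / ell x) + lip_const d g (V \<omega> x) * ?G) * ?R)"
    proof (rule with_prob_at_least_mono[OF bound], rule ballI)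
      fix \<omega> x assume *: "\<omega> \<in> space M" "x \<in> S"
        "\<forall>x\<in>S. ?err \<omega> x \<le> c * (sqrt (\<sigma>\<^sup>2 / ell x) * ?R) + lip_const d g (V \<omega> x) * (m * (?G * ?R))"
      show "?err \<omega> x \<le> (c + m) * (sqrt (3 * \<sigma>\<^sup>2 / ell x) + lip_const d g (V \<omega> x) * ?G) * ?R"
        by (rule combine[OF *(1,2) ell[OF *(2)] order_refl order_refl bspec[OF *(3,2)]])
    qed
    fix b :: real assume b: "0 < b" "\<forall>x\<in>S. b \<le> ell x"
    show "with_prob_at_least M (1 - 3 * \<delta>) (\<lambda>\<omega>. (SUP x\<in>S. ereal (?err \<omega> x))
        \<le> ereal ((c + m) * (sqrt (3 * \<sigma>\<^sup>2 / b) + L * ?G) * ?R))"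
    \<comment> \<open>The right-hand side no longer depends on x, so the pointwise bounds pass to
      the supremum on the same event.\<close>
    proof (rule with_prob_at_least_mono[OF bound], rule SUP_least)
      fix \<omega> x assume *: "\<omega> \<in> space M" "x \<in> S"
        "\<forall>x\<in>S. ?err \<omega> x \<le> c * (sqrt (\<sigma>\<^sup>2 / ell x) * ?R) + lip_const d g (V \<omega> x) * (m * (?G * ?R))"
      show "ereal (?err \<omega> x) \<le> ereal ((c + m) * (sqrt (3 * \<sigma>\<^sup>2 / b) + L * ?G) * ?R)"
        unfolding ereal_less_eq
        by (rule combine[OF *(1,2) b(1) bspec[OF b(2) *(2)] lip_const_le[OF lipV[OF *(1,2)]] bspec[OF *(3,2)]])
    qed
  qed
qed

end
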